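(* Let $n \in \mathbb{N}$ and $0<\varepsilon < 1/64$ with $n > \varepsilon^{-40}$. If $D$ is an $n$-vertex oriented graph with $\delta^0(D) > \frac{3}{8}n + \varepsilon n$, then $D$ contains a (directed) Hamilton cycle.
   Context: An oriented graph is a finite directed graph without loops in which there is at most one edge between each pair of distinct vertices. $\delta^0(D)$ is the minimum semi-degree, i.e. the minimum of the minimum outdegree and the minimum indegree of $D$. A Hamilton cycle in a digraph is a directed cycle passing through every vertex. *)

theory Defs
  imports Complex_Main "Graph_Theory.Digraph" "Graph_Theory.Arc_Walk"
begin

text \<open>
  The unordered pair of ends determines the arc. This excludes both parallel arcs and
  pairs of opposite arcs.
\<close>
locale oriented_graph = fin_digraph + loopfree_digraph +
  assumes at_most_one_arc: "\<lbrakk>e1 \<in> arcs G; e2 \<in> arcs G;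
    {tail G e1, head G e1} = {tail G e2, head G e2}\<rbrakk> \<Longrightarrow> e1 = e2"

sublocale oriented_graph \<subseteq> digraph
  by unfold_locales (rule at_most_one_arc, auto simp: arc_to_ends_def)

lemma (in oriented_graph) no_opposite_arcs:
  assumes "u \<rightarrow>\<^bsub>G\<^esub> v"
  shows "\<not> v \<rightarrow>\<^bsub>G\<^esub> u"
proof
  assume "v \<rightarrow>\<^bsub>G\<^esub> u"
  then obtain e2 where e2: "e2 \<in> arcs G" "tail G e2 = v" "head G e2 = u" by auto
  from assms obtain e1 where e1: "e1 \<in> arcs G" "tail G e1 = u" "head G e1 = v" by auto
  from e1 e2 have "e1 = e2" by (intro at_most_one_arc) auto
  with e1 e2 no_loops[of e1] show False by simp
qed

text \<open>Only meaningful for digraphs with a finite nonempty vertex set.\<close>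
definition min_semidegree :: "('a, 'b) pre_digraph \<Rightarrow> nat" where
  "min_semidegree G =
    min (Min (out_degree G ` verts G)) (Min (in_degree G ` verts G))"

text \<open>
  A cycle is a list of arcs; the vertices it passes through are the tails of its arcs.
\<close>
definition (in pre_digraph) hamilton_cycle :: "'b awalk \<Rightarrow> bool" where
  "hamilton_cycle p \<longleftrightarrow> cycle p \<and> tail G ` set p = verts G"

end

(*
  An oriented graph with minimum semidegree (3/8 + eps) n expands robustly, so alternating
  sequences of bounded length lead from any vertex to any other one while avoiding a small
  forbidden set. Switching a permutation along such a sequence repairs a non-edge, which gives
  1-factors, and merges a short cycle into others, which gives 1-factors with a bounded number
  of cycles. An absorbing cycle is set aside first. It is built from gadgets, each of which can
  insert any path whose first vertex is an out-neighbour of x and whose last vertex is an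
  in-neighbour of y, for a pair (x, y) attached to the gadget. Choosing the pairs one after the
  other so as to decrease an exponential potential, logarithmically many gadgets serve every
  pair of path ends as often as needed. The few long cycles covering the remaining vertices are
  opened anywhere and absorbed one by one.
*)
theory Submission
  imports Defs "HOL-Combinatorics.Cycles" "HOL-Combinatorics.Orbits" "HOL-Library.Multiset"
begin

section \<open>Robust expansion\<close>

text \<open>Both are tied to powers of \<open>q\<close>, an integer about 1/\<epsilon>: the cycles
  have length about n/q^5 or more, so there are at most q^6 of them, and every pair is served q^6
  times. As the cycles may be opened anywhere, all n^2 pairs must be served, which costs a factor
  log n in the size of the absorbing cycle. That cycle may have at most \<open>nu\<close>/2
  vertices, where \<open>nu\<close> = n/(32q), so that the rest still expands; n \<ge> q^39 leaves
  ample room. The obstacle to long cycles is that a switch can also cut a cycle. Switched vertices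
  are therefore kept more than L steps apart along the cycles, so that a piece entering a new cycle
  is a whole old cycle or has at least L vertices. This is why alternating sequences are built with
  an excluded set around each of their members.\<close>

definition edges_between :: "('a \<Rightarrow> 'a \<Rightarrow> bool) \<Rightarrow> 'a set \<Rightarrow> 'a set \<Rightarrow> nat" where
  "edges_between E X Y = card {(x, y). x \<in> X \<and> y \<in> Y \<and> E x y}"

lemma finite_edge_pairs:
  assumes "finite X" "finite Y"
  shows "finite {(x, y). x \<in> X \<and> y \<in> Y \<and> E x y}"
  by (rule finite_subset[of _ "X \<times> Y"]) (use assms in auto)

lemma edges_between_Un_right:
  assumes "finite X" "finite Y" "finite Z" "Y \<inter> Z = {}"
  shows "edges_between E X (Y \<union> Z) = edges_between E X Y + edges_between E X Z"
proof -
  have "{(x, y). x \<in> X \<and> y \<in> Y \<union> Z \<and> E x y}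
      = {(x, y). x \<in> X \<and> y \<in> Y \<and> E x y} \<union> {(x, y). x \<in> X \<and> y \<in> Z \<and> E x y}" by auto
  then show ?thesis unfolding edges_between_def
    using assms by (subst card_Un_disjoint[symmetric]) (auto intro: finite_edge_pairs)
qed

lemma edges_between_Un_left:
  assumes "finite X" "finite Y" "finite Z" "X \<inter> Y = {}"
  shows "edges_between E (X \<union> Y) Z = edges_between E X Z + edges_between E Y Z"
proof -
  have "{(x, y). x \<in> X \<union> Y \<and> y \<in> Z \<and> E x y}
      = {(x, y). x \<in> X \<and> y \<in> Z \<and> E x y} \<union> {(x, y). x \<in> Y \<and> y \<in> Z \<and> E x y}" by auto
  then show ?thesis unfolding edges_between_def
    using assms by (subst card_Un_disjoint[symmetric]) (auto intro: finite_edge_pairs)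
qed

lemma edges_between_eq_sum_out:
  assumes "finite X" "finite Y"
  shows "edges_between E X Y = (\<Sum>x\<in>X. card {y \<in> Y. E x y})"
proof -
  have "{(x, y). x \<in> X \<and> y \<in> Y \<and> E x y} = (SIGMA x:X. {y \<in> Y. E x y})" by auto
  then show ?thesis unfolding edges_between_def using assms by (simp add: card_SigmaI)
qed

lemma edges_between_converse: "edges_between E X Y = edges_between (\<lambda>x y. E y x) Y X"
proof -
  have "{(x, y). x \<in> X \<and> y \<in> Y \<and> E x y} = prod.swap ` {(y, x). y \<in> Y \<and> x \<in> X \<and> E x y}"
    by auto
  then show ?thesis unfolding edges_between_def by (simp add: card_image)
qed

lemma edges_between_eq_sum_in:
  assumes "finite X" "finite Y"
  shows "edges_between E X Y = (\<Sum>y\<in>Y. card {x \<in> X. E x y})"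
  using edges_between_eq_sum_out[OF assms(2,1), of "\<lambda>x y. E y x"] edges_between_converse[of E X Y]
  by simp

lemma edges_between_le:
  assumes "finite X" "finite Y"
  shows "edges_between E X Y \<le> card X * card Y"
  unfolding edges_between_def card_cartesian_product[symmetric]
  by (rule card_mono) (use assms in auto)

lemma edges_between_mono:
  assumes "finite X'" "finite Y'" "X \<subseteq> X'" "Y \<subseteq> Y'"
  shows "edges_between E X Y \<le> edges_between E X' Y'"
  unfolding edges_between_def
  by (rule card_mono) (use assms in \<open>auto intro: finite_edge_pairs\<close>)

text \<open>The pairs joined in one direction and those joined in the other are disjoint subsets of
  X \<times> Y. For \<open>X = Y\<close> this is the tournament bound: at most half of all ordered
  pairs are edges.\<close>

lemma edges_between_add_le_of_asym:
  assumes "finite X" "finite Y" and asym: "\<And>x y. E x y \<Longrightarrow> \<not> E y x"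
  shows "edges_between E X Y + edges_between E Y X \<le> card X * card Y"
proof -
  let ?A = "{(x, y). x \<in> X \<and> y \<in> Y \<and> E x y}" and ?B = "{(x, y). x \<in> X \<and> y \<in> Y \<and> E y x}"
  have "edges_between E X Y + edges_between E Y X = card ?A + card ?B"
    by (simp add: edges_between_converse[of E Y X]) (simp add: edges_between_def)
  also have "\<dots> = card (?A \<union> ?B)"
    using assms by (subst card_Un_disjoint) (auto intro: finite_edge_pairs)
  also have "\<dots> \<le> card (X \<times> Y)"
    by (rule card_mono) (use assms in auto)
  finally show ?thesis by (simp add: card_cartesian_product)
qed

text \<open>Serves to turn a bound on size times defect into a bound on the defect, once the size is
  known to be at least n/16.\<close>

lemma le_of_mult_le_mult:
  fixes a z :: real
  assumes "a * z \<le> k * w" "k \<le> a" "0 < k" "0 \<le> w"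
  shows "z \<le> w"
proof (rule ccontr)
  assume "\<not> z \<le> w"
  then have "k * w < k * z" "k * z \<le> a * z" using assms by (auto intro: mult_right_mono)
  then show False using assms by linarith
qed

text \<open>The natural number \<open>q\<close> stands for the inverse of \<epsilon>, so that all
  sizes can be compared as powers of \<open>q\<close>.\<close>

locale dense_oriented =
  fixes V :: "'a set" and E :: "'a \<Rightarrow> 'a \<Rightarrow> bool" and q :: nat
  assumes finite_V: "finite V"
    and E_in_V: "E x y \<Longrightarrow> x \<in> V \<and> y \<in> V"
    and asym: "E x y \<Longrightarrow> \<not> E y x"
    and outdeg: "x \<in> V \<Longrightarrow> (3 / 8 + 1 / real q) * real (card V) \<le> real (card {y \<in> V. E x y})"
    and indeg: "y \<in> V \<Longrightarrow> (3 / 8 + 1 / real q) * real (card V) \<le> real (card {x \<in> V. E x y})"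
    and q_ge: "64 \<le> q"
    and large: "q ^ 39 \<le> card V"
begin

text \<open>The common scale: the excess n/q of the degrees over 3n/8 is \<open>32 * nu\<close>. It
  is the threshold for robust neighbours and the gain in each expansion step, and half of it bounds
  the number of vertices that may be deleted.\<close>

definition nu :: real where
  "nu = real (card V) / (32 * real q)"

definition robust_out :: "'a set \<Rightarrow> 'a set" where
  "robust_out S = {v \<in> V. nu \<le> real (card {u \<in> S. E u v})}"

lemma card_V_pos: "0 < card V"
  using large q_ge by (metis gr0I less_le_trans not_numeral_le_zero zero_less_power)

lemma nu_pos: "0 < nu"
  unfolding nu_def using card_V_pos q_ge by simp

lemma card_V_eq: "real (card V) = 32 * real q * nu"
  unfolding nu_def using q_ge by simp

lemma card_ge_2048_nu: "2048 * nu \<le> real (card V)"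
  unfolding card_V_eq using q_ge nu_pos by simp

lemma degree_eq: "(3 / 8 + 1 / real q) * real (card V) = 3 / 8 * real (card V) + 32 * nu"
  unfolding nu_def using q_ge by (simp add: field_simps)

text \<open>By inclusion and exclusion, an in-neighbourhood of size 3n/8 + 32 \<open>nu\<close>
  meets \<open>S\<close> in at least 32 \<open>nu\<close> vertices.\<close>

lemma robust_out_eq_V:
  assumes "S \<subseteq> V" "5 / 8 * real (card V) \<le> real (card S)"
  shows "robust_out S = V"
proof -
  have "nu \<le> real (card {u \<in> S. E u v})" if "v \<in> V" for v
  proof -
    have fin: "finite S" using assms(1) finite_V finite_subset by auto
    have "card S + card {u \<in> V. E u v} = card (S \<union> {u \<in> V. E u v}) + card (S \<inter> {u \<in> V. E u v})"
      by (rule card_Un_Int) (use fin finite_V in auto)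
    moreover have "card (S \<union> {u \<in> V. E u v}) \<le> card V"
      by (rule card_mono) (use assms finite_V in auto)
    moreover have "S \<inter> {u \<in> V. E u v} = {u \<in> S. E u v}" using assms by auto
    ultimately have "real (card S) + real (card {u \<in> V. E u v}) \<le> real (card V) + real (card {u \<in> S. E u v})"
      by simp
    then show ?thesis
      using indeg[OF that] assms(2) nu_pos unfolding degree_eq by simp
  qed
  then show ?thesis unfolding robust_out_def by auto
qed

text \<open>
  The edges missing from \<open>S\<close> to the complement of its robust out-neighbourhood force
  \<open>A = S \<inter> RN\<close> and \<open>C = V - (S \<union> RN)\<close> to be
  nearly tournaments fed by \<open>B = RN - S\<close>, and \<open>D = S - RN\<close> to be nearly independent. Twice
  the average-degree bounds of \<open>A\<close>, \<open>C\<close> and \<open>D\<close> sum to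
  \<open>8 \<delta> \<le> 3 (|A| + |C|) + 6 |B|\<close>, which is about \<open>3 n\<close> unless \<open>B\<close> is larger than \<open>D\<close>.
\<close>
lemma robust_expansion:
  assumes S: "S \<subseteq> V" and lower: "3 / 8 * real (card V) \<le> real (card S)"
  shows "robust_out S = V \<or> real (card S) + nu \<le> real (card (robust_out S))"
proof (rule ccontr)
  assume neg: "\<not> ?thesis"
  let ?n = "real (card V)"
  let ?RN = "robust_out S"
  define A where "A = S \<inter> ?RN"
  define B where "B = ?RN - S"
  define C where "C = V - S - ?RN"
  define D where "D = S - ?RN"
  define a where "a = real (card A)"
  define b where "b = real (card B)"
  define c where "c = real (card C)"
  define d where "d = real (card D)"
  have RN: "?RN \<subseteq> V" unfolding robust_out_def by auto
  have sub: "A \<subseteq> V" "B \<subseteq> V" "C \<subseteq> V" "D \<subseteq> V" using S RN unfolding A_def B_def C_def D_def by auto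
  have fin: "finite A" "finite B" "finite C" "finite D" "finite S" "finite ?RN"
    using sub S RN finite_V by (meson finite_subset)+
  have V_eq: "V = (A \<union> B) \<union> (C \<union> D)" using S RN unfolding A_def B_def C_def D_def by auto
  have S_eq: "S = A \<union> D" and RN_eq: "?RN = A \<union> B" using S RN unfolding A_def B_def C_def D_def by auto
  have disj: "A \<inter> B = {}" "A \<inter> C = {}" "A \<inter> D = {}" "B \<inter> C = {}" "B \<inter> D = {}" "C \<inter> D = {}"
    unfolding A_def B_def C_def D_def by auto
  have disj2: "(A \<union> B) \<inter> (C \<union> D) = {}" using disj by auto
  have card_S: "real (card S) = a + d" unfolding S_eq a_def d_def using fin disj by (simp add: card_Un_disjoint)
  have card_RN: "real (card ?RN) = a + b" unfolding RN_eq a_def b_def using fin disj by (simp add: card_Un_disjoint)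
  have "card V = (card A + card B) + (card C + card D)"
    using fin disj disj2 by (subst V_eq) (simp add: card_Un_disjoint)
  then have n_eq: "?n = a + b + c + d" unfolding a_def b_def c_def d_def by simp
  have nonneg: "0 \<le> a" "0 \<le> b" "0 \<le> c" "0 \<le> d" unfolding a_def b_def c_def d_def by auto
  have upper: "real (card S) < 5 / 8 * ?n" using robust_out_eq_V[OF S] neg by force
  have b_less: "b < d + nu" using neg card_S card_RN by simp
  let ?e = "\<lambda>X Y. real (edges_between E X Y)"
  have few: "?e S (C \<union> D) \<le> nu * ?n"
  proof -
    have "?e S (C \<union> D) = (\<Sum>y\<in>C \<union> D. real (card {x \<in> S. E x y}))"
      using edges_between_eq_sum_in[of S "C \<union> D" E] fin by simp
    also have "\<dots> \<le> (\<Sum>y\<in>C \<union> D. nu)"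
    proof (rule sum_mono)
      fix y assume "y \<in> C \<union> D"
      then have "y \<in> V" "y \<notin> ?RN" using sub unfolding C_def D_def by auto
      then show "real (card {x \<in> S. E x y}) \<le> nu" unfolding robust_out_def by auto
    qed
    also have "\<dots> = nu * (c + d)" using fin disj unfolding c_def d_def by (simp add: card_Un_disjoint)
    also have "\<dots> \<le> nu * ?n" using nu_pos n_eq nonneg by (intro mult_left_mono) auto
    finally show ?thesis .
  qed
  have few': "?e X Y \<le> nu * ?n" if "X \<subseteq> S" "Y \<subseteq> C \<union> D" for X Y
    using edges_between_mono[of S "C \<union> D" X Y E] few that fin by fastforce
  have split_V: "?e X V = ?e X A + ?e X B + ?e X (C \<union> D)" if "finite X" for X
    using that fin disj disj2
    by (subst V_eq) (simp add: edges_between_Un_right)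
  have split_V': "?e V X = ?e A X + ?e B X + ?e C X + ?e D X" if "finite X" for X
    using that fin disj disj2
    by (subst V_eq) (simp add: edges_between_Un_left)
  have split_CD: "?e X (C \<union> D) = ?e X C + ?e X D" if "finite X" for X
    using that fin disj by (simp add: edges_between_Un_right)
  have out_sum: "(3 / 8 * ?n + 32 * nu) * real (card X) \<le> ?e X V" if "X \<subseteq> V" for X
  proof -
    have "(3 / 8 * ?n + 32 * nu) * real (card X) = (\<Sum>x\<in>X. 3 / 8 * ?n + 32 * nu)" by simp
    also have "\<dots> \<le> (\<Sum>x\<in>X. real (card {y \<in> V. E x y}))"
      using outdeg that unfolding degree_eq by (intro sum_mono) auto
    finally show ?thesis using edges_between_eq_sum_out[of X V E] that finite_V finite_subset by fastforce
  qed
  have in_sum: "(3 / 8 * ?n + 32 * nu) * real (card X) \<le> ?e V X" if "X \<subseteq> V" for X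
  proof -
    have "(3 / 8 * ?n + 32 * nu) * real (card X) = (\<Sum>x\<in>X. 3 / 8 * ?n + 32 * nu)" by simp
    also have "\<dots> \<le> (\<Sum>x\<in>X. real (card {y \<in> V. E y x}))"
      using indeg that unfolding degree_eq by (intro sum_mono) auto
    finally show ?thesis using edges_between_eq_sum_in[of V X E] that finite_V finite_subset by fastforce
  qed
  have pair: "?e X Y + ?e Y X \<le> real (card X) * real (card Y)" if "finite X" "finite Y" for X Y
    using edges_between_add_le_of_asym[OF that, of E] asym by (metis of_nat_add of_nat_le_iff of_nat_mult)
  have crude: "?e X Y \<le> real (card X) * real (card Y)" if "finite X" "finite Y" for X Y
    using edges_between_le[OF that, of E] by (metis of_nat_le_iff of_nat_mult)
  \<comment> \<open>The bound \<open>nu * ?n\<close> is written with the factor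
    \<open>?n / 16\<close> in front so that it cancels as soon as the set has at least n/16
    vertices.\<close>
  have A_ineq: "a * (3 / 8 * ?n + 32 * nu - a / 2 - b) \<le> ?n / 16 * (16 * nu)"
  proof -
    have "?e A (C \<union> D) \<le> nu * ?n" using few'[of A "C \<union> D"] unfolding A_def by auto
    moreover have "2 * ?e A A \<le> a * a" using pair[of A A] fin a_def by simp
    moreover have "?e A B \<le> a * b" using crude[of A B] fin a_def b_def by simp
    ultimately show ?thesis
      using out_sum[of A] split_V[of A] fin sub a_def by (simp add: algebra_simps)
  qed
  have C_ineq: "c * (3 / 8 * ?n + 32 * nu - c / 2 - b) \<le> ?n / 16 * (16 * nu)"
  proof -
    have "?e A C + ?e D C = ?e S C" unfolding S_eq using fin disj by (simp add: edges_between_Un_left)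
    moreover have "?e S C \<le> nu * ?n" using few'[of S C] by auto
    moreover have "2 * ?e C C \<le> c * c" using pair[of C C] fin c_def by simp
    moreover have "?e B C \<le> c * b" using crude[of B C] fin b_def c_def by (simp add: algebra_simps)
    ultimately show ?thesis
      using in_sum[of C] split_V'[of C] fin sub c_def by (simp add: algebra_simps)
  qed
  \<comment> \<open>In-degrees and out-degrees are added. Apart from the few edges inside
    \<open>D\<close>, they are carried by pairs between \<open>D\<close> and the other parts, each
    of which counts at most once.\<close>
  have D_ineq: "d * (3 / 4 * ?n + 64 * nu - a - b - c) \<le> ?n / 16 * (32 * nu)"
  proof -
    have "?e D D \<le> nu * ?n" using few'[of D D] unfolding D_def by auto
    moreover have "?e A D + ?e D A \<le> d * a" using pair[of A D] fin a_def d_def by (simp add: algebra_simps)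
    moreover have "?e B D + ?e D B \<le> d * b" using pair[of B D] fin b_def d_def by (simp add: algebra_simps)
    moreover have "?e C D + ?e D C \<le> d * c" using pair[of C D] fin c_def d_def by (simp add: algebra_simps)
    ultimately show ?thesis
      using in_sum[of D] out_sum[of D] split_V[of D] split_V'[of D] split_CD[of D] fin sub d_def
      by (simp add: algebra_simps)
  qed
  have pos16: "0 < ?n / 16" using card_V_pos by simp
  note small = card_ge_2048_nu nu_pos
  have A_big: "3 / 8 * ?n + 32 * nu - a / 2 - b \<le> 16 * nu" if "?n / 16 \<le> a"
    using le_of_mult_le_mult[OF A_ineq that pos16] nu_pos by simp
  have C_big: "3 / 8 * ?n + 32 * nu - c / 2 - b \<le> 16 * nu" if "?n / 16 \<le> c"
    using le_of_mult_le_mult[OF C_ineq that pos16] nu_pos by simp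
  have D_big: "3 / 4 * ?n + 64 * nu - a - b - c \<le> 32 * nu" if "?n / 16 \<le> d"
    using le_of_mult_le_mult[OF D_ineq that pos16] nu_pos by simp
  show False
  \<comment> \<open>A large \<open>d\<close> is still below n/4 by \<open>D_big\<close>, hence so is
    \<open>b\<close>, whereas \<open>A_big\<close> and \<open>C_big\<close> together with
    \<open>b_less\<close> force b > n/4. A small \<open>d\<close> keeps \<open>b\<close> near n/16
    at most, whereas \<open>A_big\<close> and \<open>C_big\<close> force b > n/6.\<close>
  proof (cases "?n / 16 \<le> d")
    case True
    note D = D_big[OF True]
    have "?n / 16 \<le> a" using D lower card_S n_eq small by argo
    moreover have "?n / 16 \<le> c" using D upper card_S n_eq small b_less by argo
    ultimately show ?thesis using D A_big C_big n_eq b_less small by argo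
  next
    case False
    have "?n / 16 \<le> a" using False lower card_S n_eq small by argo
    moreover have "?n / 16 \<le> c" using False upper card_S n_eq small b_less by argo
    ultimately show ?thesis using False A_big C_big n_eq b_less small by argo
  qed
qed

end

section \<open>Switching sequences and 1-factors\<close>

lemma distinct_of_sorted_wrt:
  assumes "sorted_wrt R xs" "\<And>x. \<not> R x x"
  shows "distinct xs"
  using assms(1) by (induction xs) (use assms(2) in auto)

lemma sorted_wrt_cases:
  assumes "sorted_wrt P xs" "x \<in> set xs" "y \<in> set xs" "x \<noteq> y"
  shows "P x y \<or> P y x"
  using assms by (induction xs) auto

lemma real_le_add: "a \<le> b + c \<Longrightarrow> real a \<le> real b + real c"
  by (metis of_nat_add of_nat_mono)

lemma ex_in_diff_of_card_less:
  assumes "finite X" "card X < card S"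
  obtains w where "w \<in> S" "w \<notin> X"
  using assms card_mono[of X S] by (metis leD subsetI)

text \<open>
  Switching along the vertices \<open>u\<^sub>0, \<dots>, u\<^sub>r\<close> of \<open>cs\<close> replaces each successor \<open>\<sigma> u\<^sub>i\<close>
  by \<open>\<sigma> u\<^sub>i\<^sub>+\<^sub>1\<close> (indices modulo \<open>r + 1\<close>).
\<close>
definition switch :: "('a \<Rightarrow> 'a) \<Rightarrow> 'a list \<Rightarrow> 'a \<Rightarrow> 'a" where
  "switch \<sigma> cs = \<sigma> \<circ> cycle_of_list cs"

lemma switch_permutes:
  assumes "\<sigma> permutes W" "set cs \<subseteq> W"
  shows "switch \<sigma> cs permutes W"
  unfolding switch_def using assms cycle_permutes permutes_compose permutes_subset by metis

lemma map_cycle_of_list: "distinct cs \<Longrightarrow> map (cycle_of_list cs) cs = rotate1 cs"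
  using cyclic_rotation[of cs 1] by simp

lemma switch_nth:
  assumes "distinct cs" "i < length cs"
  shows "switch \<sigma> cs (cs ! i) = \<sigma> (cs ! (Suc i mod length cs))"
proof -
  have "cycle_of_list cs (cs ! i) = map (cycle_of_list cs) cs ! i" using assms by simp
  also have "\<dots> = rotate1 cs ! i" using map_cycle_of_list[OF assms(1)] by simp
  also have "\<dots> = cs ! (Suc i mod length cs)" using assms by (simp add: nth_rotate1)
  finally show ?thesis by (simp add: switch_def)
qed

lemma switch_outside: "u \<notin> set cs \<Longrightarrow> switch \<sigma> cs u = \<sigma> u"
  by (simp add: switch_def id_outside_supp)

lemma switch_edges:
  assumes dist: "distinct (u # us)" and ne: "us \<noteq> []" and hd: "E u (\<sigma> (hd us))" and succ: "successively (\<lambda>v w. E v (\<sigma> w)) us"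
    and last: "E (last us) (\<sigma> u)" and v: "v \<in> set (u # us)"
  shows "E v (switch \<sigma> (u # us) v)"
proof -
  let ?cs = "u # us"
  obtain i where i: "i < length ?cs" "v = ?cs ! i" using v by (metis in_set_conv_nth)
  have s: "successively (\<lambda>v w. E v (\<sigma> w)) ?cs" using hd succ by (simp add: successively_Cons)
  show ?thesis
  proof (cases "Suc i < length ?cs")
    case True
    then have "E v (\<sigma> (?cs ! (Suc i mod length ?cs)))" using successively_nth[OF s True] i by simp
    then show ?thesis using switch_nth[OF dist i(1), of \<sigma>] i(2) by metis
  next
    case False
    then have "Suc i = length ?cs" using i by simp
    then have "v = last us" "Suc i mod length ?cs = 0" using i ne by (auto simp: last_conv_nth nth_Cons split: nat.split)
    then have "E v (\<sigma> (?cs ! (Suc i mod length ?cs)))" using last by simp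
    then show ?thesis using switch_nth[OF dist i(1), of \<sigma>] i(2) by metis
  qed
qed

section \<open>Alternating sequences in dense oriented graphs\<close>

context dense_oriented
begin

lemma nu_ge: "real q ^ 37 \<le> nu"
proof -
  have "real q ^ 37 * (32 * real q) \<le> real q ^ 37 * (real q * real q)"
    using q_ge by (intro mult_left_mono mult_right_mono) auto
  also have "\<dots> = real (q ^ 39)" unfolding of_nat_power by (simp flip: power_Suc2 add: mult.assoc[symmetric])
  also have "\<dots> \<le> real (card V)" using large by (rule of_nat_mono)
  finally show ?thesis unfolding nu_def using q_ge by (simp add: pos_le_divide_eq)
qed

text \<open>The number of vertices of an alternating sequence, one in each of the levels 0 to 40 q.
  Growing from 3n/8 by \<open>nu\<close>/2 per level, 40 q steps gain 20 q \<open>nu\<close> = 5n/8.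
  That \<open>R\<close> is odd matters for the gadgets.\<close>

definition R :: nat where
  "R = 40 * q + 1"

lemma R_le: "real R \<le> real q ^ 2"
proof -
  have "real R \<le> 41 * real q" unfolding R_def using q_ge by simp
  also have "\<dots> \<le> real q * real q" using q_ge by (intro mult_right_mono) auto
  finally show ?thesis by (simp add: power2_eq_square)
qed

lemma R_less_nu: "2 * real R + 2 < nu"
proof -
  have q: "1 < real q" using q_ge by simp
  have "2 * real R + 2 \<le> 4 * real q ^ 2" using R_le one_le_power[of "real q" 2] q by linarith
  also have "\<dots> < real q * real q ^ 2" using q_ge by (intro mult_strict_right_mono) auto
  also have "\<dots> = real q ^ 3" by (simp add: power3_eq_cube power2_eq_square)
  also have "\<dots> \<le> real q ^ 37" using q by (intro power_increasing) auto
  finally show ?thesis using nu_ge by simp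
qed

text \<open>Vertices at which an alternating sequence from \<open>x\<close> can end after i further
  steps, with at least \<open>nu\<close> choices for each predecessor. A level is the
  \<sigma>-preimage in \<open>W\<close> of the robust out-neighbourhood of the preceding
  one.\<close>

primrec level :: "'a set \<Rightarrow> ('a \<Rightarrow> 'a) \<Rightarrow> 'a \<Rightarrow> nat \<Rightarrow> 'a set" where
  "level W \<sigma> x 0 = {u \<in> W. E x (\<sigma> u)}"
| "level W \<sigma> x (Suc i) = {u \<in> W. nu \<le> real (card {w \<in> level W \<sigma> x i. E w (\<sigma> u)})}"

lemma level_subset: "level W \<sigma> x i \<subseteq> W"
  by (cases i) auto

lemma card_preimage_permutes:
  assumes W: "W \<subseteq> V" and perm: "\<sigma> permutes W" and T: "T \<subseteq> V"
  shows "card T \<le> card {u \<in> W. \<sigma> u \<in> T} + card (V - W)"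
proof -
  have fin: "finite W" "finite T" using W T finite_V finite_subset by auto
  have "\<sigma> ` {u \<in> W. \<sigma> u \<in> T} = T \<inter> \<sigma> ` W" by auto
  then have "\<sigma> ` {u \<in> W. \<sigma> u \<in> T} = T \<inter> W" unfolding permutes_image[OF perm] .
  then have "card {u \<in> W. \<sigma> u \<in> T} = card (T \<inter> W)"
    using card_image[OF permutes_inj_on[OF perm], of "{u \<in> W. \<sigma> u \<in> T}"] by simp
  moreover have "card T = card (T \<inter> W) + card (T - W)"
    using card_Int_Diff[OF fin(2)] .
  moreover have "card (T - W) \<le> card (V - W)"
    using T finite_V by (intro card_mono) auto
  ultimately show ?thesis by simp
qed

text \<open>Robust expansion gains \<open>nu\<close>, and restricting to \<open>W\<close> loses at
  most \<open>nu\<close>/2, so each step gains \<open>nu\<close>/2 net. The cap is reached when the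
  robust out-neighbourhood is all of \<open>V\<close>.\<close>

lemma card_level:
  assumes W: "W \<subseteq> V" and few: "2 * real (card (V - W)) \<le> nu" and perm: "\<sigma> permutes W" and x: "x \<in> V"
  shows "min (real (card V) - nu / 2) (3 / 8 * real (card V) + real i * (nu / 2)) \<le> real (card (level W \<sigma> x i))"
proof (induction i)
  case 0
  have le: "card {y \<in> V. E x y} \<le> card {u \<in> W. \<sigma> u \<in> {y \<in> V. E x y}} + card (V - W)"
    by (rule card_preimage_permutes[OF W perm]) auto
  have "{u \<in> W. \<sigma> u \<in> {y \<in> V. E x y}} = level W \<sigma> x 0" using E_in_V by auto
  with le have "real (card {y \<in> V. E x y}) \<le> real (card (level W \<sigma> x 0)) + real (card (V - W))"
    by (intro real_le_add) simp
  then show ?case using outdeg[OF x] nu_pos few unfolding degree_eq by simp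
next
  case (Suc i)
  let ?S = "level W \<sigma> x i"
  have S: "?S \<subseteq> V" using level_subset W by fast
  have le0: "card (robust_out ?S) \<le> card {u \<in> W. \<sigma> u \<in> robust_out ?S} + card (V - W)"
    by (rule card_preimage_permutes[OF W perm]) (auto simp: robust_out_def)
  have "{u \<in> W. \<sigma> u \<in> robust_out ?S} = level W \<sigma> x (Suc i)"
    using W permutes_in_image[OF perm] by (auto simp: robust_out_def)
  with le0 have le: "real (card (robust_out ?S)) \<le> real (card (level W \<sigma> x (Suc i))) + real (card (V - W))"
    by (intro real_le_add) simp
  have "3 / 8 * real (card V) \<le> min (real (card V) - nu / 2) (3 / 8 * real (card V) + real i * (nu / 2))"
    using card_ge_2048_nu nu_pos by (simp add: zero_le_mult_iff)
  then have "3 / 8 * real (card V) \<le> real (card ?S)" using Suc by linarith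
  from robust_expansion[OF S this] show ?case
  proof
    assume "robust_out ?S = V"
    then show ?thesis using le few by simp
  next
    assume "real (card ?S) + nu \<le> real (card (robust_out ?S))"
    then have grow: "real (card ?S) + nu / 2 \<le> real (card (level W \<sigma> x (Suc i)))" using le few by linarith
    have step: "min a (b + g) \<le> y" if "min a b \<le> x" "x + g \<le> y" "0 < g" for a b g x y :: real
      using that by (auto simp: min_def split: if_splits)
    have "0 < nu / 2" using nu_pos by simp
    from step[OF Suc grow this] have "min (real (card V) - nu / 2)
        (3 / 8 * real (card V) + real i * (nu / 2) + nu / 2) \<le> real (card (level W \<sigma> x (Suc i)))" .
    moreover have "real (Suc i) * (nu / 2) = real i * (nu / 2) + nu / 2" by (simp add: distrib_right)
    ultimately show ?thesis by (simp only: add.assoc)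
  qed
qed

text \<open>The sequence is chosen greedily from its last vertex backwards. Every chosen
  \<open>u\<close> excludes the set \<open>K u\<close> for the vertices before it, and
  \<open>nu\<close> candidates outnumber all exclusions. Suitable \<open>K\<close> yield
  distinctness, disjointness from the \<sigma>-image, or spacing along cycles.\<close>

lemma chain_to_level:
  assumes W: "W \<subseteq> V"
    and K: "\<And>u. u \<in> W \<Longrightarrow> finite (K u) \<and> card (K u) \<le> c"
  shows "\<lbrakk>u \<in> level W \<sigma> x i; finite X; real (card X + i * c) < nu\<rbrakk> \<Longrightarrow>
    \<exists>us. length us = i \<and> set us \<subseteq> W - X \<and> E x (\<sigma> (hd (us @ [u])))
      \<and> successively (\<lambda>v w. E v (\<sigma> w)) (us @ [u]) \<and> sorted_wrt (\<lambda>v w. v \<notin> K w) (us @ [u])"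
proof (induction i arbitrary: u X)
  case 0
  then show ?case by (intro exI[of _ "[]"]) auto
next
  case (Suc i)
  let ?S = "{w \<in> level W \<sigma> x i. E w (\<sigma> u)}"
  have u: "u \<in> W" using Suc.prems(1) level_subset by blast
  have fin: "finite (X \<union> K u)" using K[OF u] Suc.prems by auto
  have le: "card (X \<union> K u) \<le> card X + c"
    using card_Un_le[of X "K u"] K[OF u] by linarith
  then have "card (X \<union> K u) + i * c \<le> card X + Suc i * c" by simp
  from of_nat_mono[OF this, where 'a=real] have less: "real (card (X \<union> K u) + i * c) < nu"
    using Suc.prems(3) by linarith
  have "real (card (X \<union> K u)) \<le> real (card (X \<union> K u) + i * c)" by (rule of_nat_mono) simp
  moreover have "nu \<le> real (card ?S)" using Suc.prems(1) by simp
  ultimately have "real (card (X \<union> K u)) < real (card ?S)" using less by linarith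
  then have "card (X \<union> K u) < card ?S" by (simp only: of_nat_less_iff)
  then obtain w where w: "w \<in> ?S" "w \<notin> X \<union> K u"
    using ex_in_diff_of_card_less[OF fin, of ?S] by blast
  with Suc.IH[OF _ fin less, of w] obtain us where us: "length us = i" "set us \<subseteq> W - (X \<union> K u)"
    "E x (\<sigma> (hd (us @ [w])))" "successively (\<lambda>v w. E v (\<sigma> w)) (us @ [w])"
    "sorted_wrt (\<lambda>v w. v \<notin> K w) (us @ [w])" by auto
  have "w \<in> W" using w(1) level_subset[of W \<sigma> x i] by auto
  moreover have "hd ((us @ [w]) @ [u]) = hd (us @ [w])" by (cases us) auto
  moreover have "sorted_wrt (\<lambda>v w. v \<notin> K w) ((us @ [w]) @ [u])"
    using us(2,5) w(2) by (subst sorted_wrt_append) auto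
  moreover have "successively (\<lambda>v w. E v (\<sigma> w)) ((us @ [w]) @ [u])"
    using us(4) w(1) by (subst successively_append_iff) auto
  moreover have "length (us @ [w]) = Suc i" "set (us @ [w]) \<subseteq> W - X"
    using us(1,2) w \<open>w \<in> W\<close> by auto
  ultimately show ?case using us(3) by (intro exI[of _ "us @ [w]"]) simp
qed

text \<open>Level 40 q misses at most \<open>nu\<close>/2 vertices, so it contains at least
  \<open>nu\<close> in-neighbours of \<open>y\<close>, which cannot all lie in
  \<open>X\<close>.\<close>

lemma chain:
  assumes W: "W \<subseteq> V" and few: "2 * real (card (V - W)) \<le> nu" and perm: "\<sigma> permutes W"
    and xy: "x \<in> V" "y \<in> V" and X: "finite X" "real (card X + R * c) < nu"
    and K: "\<And>u. u \<in> W \<Longrightarrow> finite (K u) \<and> card (K u) \<le> c"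
  obtains us where "length us = R" "set us \<subseteq> W - X" "E x (\<sigma> (hd us))"
    "successively (\<lambda>v w. E v (\<sigma> w)) us" "E (last us) y" "sorted_wrt (\<lambda>v w. v \<notin> K w) us"
proof -
  let ?S = "level W \<sigma> x (40 * q)" and ?T = "{u \<in> V. E u y}"
  have "real (40 * q) * (nu / 2) = 5 / 8 * real (card V)" unfolding card_V_eq by simp
  then have S: "real (card V) - nu / 2 \<le> real (card ?S)"
    using card_level[OF W few perm xy(1), of "40 * q"] nu_pos by simp
  have SV: "?S \<subseteq> V" using level_subset W by fast
  have "card ?S + card ?T = card (?S \<union> ?T) + card (?S \<inter> ?T)"
    by (rule card_Un_Int) (use SV finite_V finite_subset in auto)
  moreover have "card (?S \<union> ?T) \<le> card V"
    by (rule card_mono) (use SV finite_V in auto)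
  ultimately have "real (card ?S) + real (card ?T) \<le> real (card V) + real (card (?S \<inter> ?T))"
    by simp
  then have "nu \<le> real (card (?S \<inter> ?T))"
    using S indeg[OF xy(2)] card_ge_2048_nu nu_pos unfolding degree_eq by simp
  moreover have "real (card X) \<le> real (card X + R * c)" by simp
  ultimately have "card X < card (?S \<inter> ?T)" using X by linarith
  then obtain u where u: "u \<in> ?S" "E u y" "u \<notin> X"
    using X ex_in_diff_of_card_less[of X "?S \<inter> ?T"] by auto
  have "real (card X + 40 * q * c) \<le> real (card X + R * c)"
    unfolding R_def by (intro of_nat_mono) auto
  then have "real (card X + 40 * q * c) < nu" using X by linarith
  from chain_to_level[where K=K and c=c, OF W K u(1) X(1) this]
  obtain us where us: "length us = 40 * q" "set us \<subseteq> W - X" "E x (\<sigma> (hd (us @ [u])))"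
    "successively (\<lambda>v w. E v (\<sigma> w)) (us @ [u])" "sorted_wrt (\<lambda>v w. v \<notin> K w) (us @ [u])" by auto
  show thesis
    by (rule that[of "us @ [u]"]) (use us u level_subset[of W \<sigma> x "40 * q"] in \<open>auto simp: R_def\<close>)
qed

text \<open>For the identity permutation an alternating sequence is an ordinary path. To keep the
  inner vertices away from \<open>x\<close> and \<open>y\<close>, these must be put into
  \<open>F\<close>.\<close>

lemma path_between:
  assumes "x \<in> V" "y \<in> V" "finite F" "2 * real (card F) \<le> nu"
  obtains ps where "length ps = R" "distinct ps" "set ps \<subseteq> V - F" "successively E (x # ps @ [y])"
proof -
  have "card (V - (V - F)) \<le> card F" by (rule card_mono) (use assms in auto)
  then have few: "2 * real (card (V - (V - F))) \<le> nu" using assms(4) by simp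
  obtain us where us: "length us = R" "set us \<subseteq> V - F - {}" "E x (id (hd us))"
    "successively (\<lambda>v w. E v (id w)) us" "E (last us) y" "sorted_wrt (\<lambda>v w. v \<notin> {w}) us"
    by (rule chain[of "V - F" id x y "{}" 1 "\<lambda>u. {u}"])
      (use assms few R_less_nu in auto)
  have ne: "us \<noteq> []" using us(1) R_def by auto
  show thesis
    by (rule that[of us])
      (use us ne distinct_of_sorted_wrt[OF us(6)] in \<open>auto simp: successively_append_iff successively_Cons\<close>)
qed

text \<open>A permutation with the greatest number of vertices mapped along an edge is taken.
  Switching at a bad vertex \<open>u\<close>, along a sequence from \<open>u\<close> to
  \<open>\<sigma> u\<close>, would make \<open>u\<close> good and keep every good vertex
  good.\<close>

lemma one_factor:
  assumes W: "W \<subseteq> V" and few: "2 * real (card (V - W)) \<le> nu"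
  obtains \<sigma> where "\<sigma> permutes W" "\<And>u. u \<in> W \<Longrightarrow> E u (\<sigma> u)"
proof -
  let ?good = "\<lambda>\<sigma>. {u \<in> W. E u (\<sigma> u)}"
  have finW: "finite W" using W finite_V finite_subset by auto
  let ?P = "{\<sigma>. \<sigma> permutes W}"
  have "finite ((\<lambda>\<sigma>. card (?good \<sigma>)) ` ?P)" "(\<lambda>\<sigma>. card (?good \<sigma>)) ` ?P \<noteq> {}"
    using finite_permutations[OF finW] by (auto intro: permutes_id)
  from Max_in[OF this] obtain \<sigma> where \<sigma>: "\<sigma> permutes W"
      "card (?good \<sigma>) = Max ((\<lambda>\<sigma>. card (?good \<sigma>)) ` ?P)" by auto
  then have max: "card (?good \<tau>) \<le> card (?good \<sigma>)" if "\<tau> permutes W" for \<tau>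
    using that finite_permutations[OF finW] by simp
  have "E u (\<sigma> u)" if u: "u \<in> W" for u
  proof (rule ccontr)
    assume bad: "\<not> E u (\<sigma> u)"
    have "\<sigma> u \<in> W" using u permutes_in_image[OF \<sigma>(1)] by simp
    then have xy: "u \<in> V" "\<sigma> u \<in> V" using u W by auto
    have "real (card {u} + R * 1) < nu" using R_less_nu by simp
    then obtain us where us: "length us = R" "set us \<subseteq> W - {u}" "E u (\<sigma> (hd us))"
      "successively (\<lambda>v w. E v (\<sigma> w)) us" "E (last us) (\<sigma> u)" "sorted_wrt (\<lambda>v w. v \<notin> {w}) us"
      using chain[of W \<sigma> u "\<sigma> u" "{u}" 1 "\<lambda>u. {u}", OF W few \<sigma>(1) xy] by auto
    have ne: "us \<noteq> []" using us(1) R_def by auto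
    have dist: "distinct (u # us)" using us(2) distinct_of_sorted_wrt[OF us(6)] by auto
    let ?\<tau> = "switch \<sigma> (u # us)"
    have sub: "set (u # us) \<subseteq> W" using us(2) u by auto
    have \<tau>: "?\<tau> permutes W" by (rule switch_permutes[OF \<sigma>(1) sub])
    have "insert u (?good \<sigma>) \<subseteq> ?good ?\<tau>"
    proof
      fix v assume v: "v \<in> insert u (?good \<sigma>)"
      show "v \<in> ?good ?\<tau>"
      proof (cases "v \<in> set (u # us)")
        case True
        then show ?thesis using switch_edges[of u us E \<sigma>, OF dist ne us(3,4,5) True] sub by blast
      next
        case False
        then show ?thesis using switch_outside[OF False, of \<sigma>] v by simp
      qed
    qed
    then have "card (insert u (?good \<sigma>)) \<le> card (?good ?\<tau>)" using finW by (intro card_mono) auto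
    then show False using bad max[OF \<tau>] finW by simp
  qed
  with \<sigma> that show thesis by blast
qed

end

section \<open>1-factors with long cycles\<close>

lemma card_orbit_le:
  assumes "(f ^^ m) x = x" "0 < m"
  shows "card (orbit f x) \<le> m"
proof -
  have "orbit f x = (\<lambda>i. (f ^^ i) x) ` {..<m}" using orbit_altdef_bounded[OF assms] by auto
  then show ?thesis by (metis card_image_le card_lessThan finite_lessThan)
qed

lemma inj_on_funpow_orbit:
  assumes "permutation f"
  shows "inj_on (\<lambda>m. (f ^^ m) x) {1..card (orbit f x)}"
proof (rule linorder_inj_onI)
  fix i j assume ij: "i < j" "i \<in> {1..card (orbit f x)}" "j \<in> {1..card (orbit f x)}"
  show "(f ^^ i) x \<noteq> (f ^^ j) x"
  proof
    assume eq: "(f ^^ i) x = (f ^^ j) x"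
    have inj: "inj f" using assms permutation_bijective bij_is_inj by blast
    have "i \<le> j" using ij(1) by simp
    from funpow_diff[OF inj this eq] have "(f ^^ (j - i)) x = x" .
    from card_orbit_le[OF this] ij show False by simp
  qed
qed auto

text \<open>\<open>orbit f x\<close> is generated from \<open>f x\<close>, so exponents start at 1,
  and the last one returns to \<open>x\<close>.\<close>

lemma orbit_eq_funpow_image:
  assumes "permutation f"
  shows "orbit f x = (\<lambda>m. (f ^^ m) x) ` {1..card (orbit f x)}"
proof -
  have "finite (orbit f x)" using finite_orbit permutation_self_in_orbit[OF assms] by fastforce
  moreover have "(\<lambda>m. (f ^^ m) x) ` {1..card (orbit f x)} \<subseteq> orbit f x"
    unfolding orbit_altdef by auto
  moreover have "card ((\<lambda>m. (f ^^ m) x) ` {1..card (orbit f x)}) = card (orbit f x)"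
    using card_image[OF inj_on_funpow_orbit[OF assms]] by simp
  ultimately show ?thesis by (metis card_subset_eq)
qed

context
  fixes \<sigma> :: "'a \<Rightarrow> 'a" and W :: "'a set" and cs :: "'a list" and L :: nat
  assumes fin: "finite W" and perm: "\<sigma> permutes W" and cs: "distinct cs" "set cs \<subseteq> W"
    and spaced: "\<And>u v m. \<lbrakk>u \<in> set cs; v \<in> set cs; u \<noteq> v; m \<le> L\<rbrakk> \<Longrightarrow> (\<sigma> ^^ m) u \<noteq> v"
begin

private lemma permutation_\<sigma>: "permutation \<sigma>"
  using perm fin permutation_permutes by blast

private lemma permutation_switch: "permutation (switch \<sigma> cs)"
  using switch_permutes[OF perm cs(2)] fin permutation_permutes by blast

private lemma finite_orbit_switch: "finite (orbit (switch \<sigma> cs) v)"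
  using finite_orbit permutation_self_in_orbit[OF permutation_switch] by fastforce

text \<open>The switched cycle jumps from \<open>cs ! i\<close> to the \<sigma>-successor of the
  next element p of \<open>cs\<close> and then follows \<sigma> until it meets \<open>cs\<close>
  again. By the spacing this cannot happen within \<open>L\<close> steps, except on returning to p
  itself.\<close>

private lemma segment_in_orbit:
  assumes i: "i < length cs" "cs ! i \<in> orbit (switch \<sigma> cs) v"
    and m: "0 < m" "m \<le> L" "m \<le> card (orbit \<sigma> (cs ! (Suc i mod length cs)))"
  shows "(\<sigma> ^^ m) (cs ! (Suc i mod length cs)) \<in> orbit (switch \<sigma> cs) v"
  using m
proof (induction m)
  case (Suc m)
  let ?p = "cs ! (Suc i mod length cs)"
  have p: "?p \<in> set cs" using i(1) by (intro nth_mem mod_less_divisor) auto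
  show ?case
  proof (cases "m = 0")
    case True
    then show ?thesis using orbit.step[OF i(2)] switch_nth[OF cs(1) i(1), of \<sigma>] by simp
  next
    case False
    then have IH: "(\<sigma> ^^ m) ?p \<in> orbit (switch \<sigma> cs) v" using Suc by simp
    have "(\<sigma> ^^ m) ?p \<noteq> ?p" using card_orbit_le[of m \<sigma> ?p] False Suc.prems by auto
    then have "(\<sigma> ^^ m) ?p \<notin> set cs" using spaced[OF p, of "(\<sigma> ^^ m) ?p" m] Suc.prems by auto
    from orbit.step[OF IH] switch_outside[OF this, of \<sigma>] show ?thesis by simp
  qed
qed simp

private lemma orbit_of_next:
  assumes i: "i < length cs" "cs ! i \<in> orbit (switch \<sigma> cs) v" and small: "card (orbit (switch \<sigma> cs) v) < L"
  shows "orbit \<sigma> (cs ! (Suc i mod length cs)) \<subseteq> orbit (switch \<sigma> cs) v"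
proof -
  let ?p = "cs ! (Suc i mod length cs)"
  let ?c = "card (orbit \<sigma> ?p)"
  let ?s = "\<lambda>M. (\<lambda>m. (\<sigma> ^^ m) ?p) ` {1..M}"
  have sub: "?s (min L ?c) \<subseteq> orbit (switch \<sigma> cs) v"
    using segment_in_orbit[OF i] by auto
  have "inj_on (\<lambda>m. (\<sigma> ^^ m) ?p) {1..min L ?c}"
    by (rule inj_on_subset[OF inj_on_funpow_orbit[OF permutation_\<sigma>]]) auto
  then have "card (?s (min L ?c)) = min L ?c" by (simp add: card_image)
  with card_mono[OF finite_orbit_switch sub] small have "?c < L" by simp
  with sub show ?thesis using orbit_eq_funpow_image[OF permutation_\<sigma>, of ?p] by simp
qed

text \<open>
  A short orbit of the switched permutation that meets \<open>cs\<close> follows, for each successive element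
  of \<open>cs\<close>, a whole orbit of \<open>\<sigma>\<close>, and therefore runs through all of \<open>cs\<close>.
\<close>
private lemma orbits_merge:
  assumes meet: "orbit (switch \<sigma> cs) v \<inter> set cs \<noteq> {}" and small: "card (orbit (switch \<sigma> cs) v) < L"
    and p: "p \<in> set cs"
  shows "orbit \<sigma> p \<subseteq> orbit (switch \<sigma> cs) v"
proof -
  obtain i where i: "i < length cs" "cs ! i \<in> orbit (switch \<sigma> cs) v"
    using meet by (metis disjoint_iff in_set_conv_nth)
  let ?j = "\<lambda>k. (i + k) mod length cs"
  have j: "?j k < length cs" for k using i(1) by (intro mod_less_divisor) auto
  have next_j: "Suc (?j k) mod length cs = ?j (Suc k)" for k by (simp add: mod_Suc_eq)
  have mem: "cs ! ?j k \<in> orbit (switch \<sigma> cs) v" for k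
  proof (induction k)
    case 0
    then show ?case using i by simp
  next
    case (Suc k)
    have "cs ! ?j (Suc k) \<in> orbit \<sigma> (cs ! ?j (Suc k))"
      by (rule permutation_self_in_orbit[OF permutation_\<sigma>])
    then show ?case using orbit_of_next[OF j Suc small] unfolding next_j by blast
  qed
  obtain l where l: "l < length cs" "p = cs ! l" using p by (metis in_set_conv_nth)
  have "i + Suc (l + (length cs - Suc i)) = l + length cs" using i(1) by simp
  then have "?j (Suc (l + (length cs - Suc i))) = l" using l(1) by (simp only: mod_add_self2 mod_less)
  with orbit_of_next[OF j mem small, of "l + (length cs - Suc i)"] l show ?thesis
    unfolding next_j by simp
qed

text \<open>Only a new cycle that meets \<open>cs\<close>, is shorter than \<open>L\<close> and
  comes from an old cycle meeting \<open>cs\<close> needs an argument: it swallows the old cycles of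
  all elements of \<open>cs\<close>, among them the one through \<open>v\<close>. Cycles that avoid
  \<open>cs\<close> do not change.\<close>

lemma min_card_orbit_switch: "min L (card (orbit \<sigma> v)) \<le> card (orbit (switch \<sigma> cs) v)"
proof (cases "card (orbit (switch \<sigma> cs) v) < L \<and> orbit (switch \<sigma> cs) v \<inter> set cs \<noteq> {} \<and> orbit \<sigma> v \<inter> set cs \<noteq> {}")
  case True
  then obtain p where p: "p \<in> orbit \<sigma> v" "p \<in> set cs" by auto
  then have "orbit \<sigma> p = orbit \<sigma> v"
    using cyclic_on_orbit'[OF permutation_\<sigma>] orbit_cyclic_eq3 by metis
  then have "orbit \<sigma> v \<subseteq> orbit (switch \<sigma> cs) v" using orbits_merge[of v p] True p by auto
  then show ?thesis using card_mono[OF finite_orbit_switch] by (simp add: min.coboundedI2)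
next
  case False
  consider "L \<le> card (orbit (switch \<sigma> cs) v)" | "orbit (switch \<sigma> cs) v \<inter> set cs = {}" | "orbit \<sigma> v \<inter> set cs = {}"
    using False by linarith
  then show ?thesis
  proof cases
    case 2
    have "orbit \<sigma> v = orbit (switch \<sigma> cs) v"
    proof (rule orbit_cong)
      show "v \<in> orbit (switch \<sigma> cs) v" by (rule permutation_self_in_orbit[OF permutation_switch])
    next
      fix s assume "s \<in> orbit (switch \<sigma> cs) v"
      then have "s \<notin> set cs" using 2 by auto
      then show "\<sigma> s = switch \<sigma> cs s" using switch_outside by metis
    qed
    then show ?thesis by simp
  next
    case 3
    have "orbit (switch \<sigma> cs) v = orbit \<sigma> v"
    proof (rule orbit_cong)
      show "v \<in> orbit \<sigma> v" by (rule permutation_self_in_orbit[OF permutation_\<sigma>])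
    next
      fix s assume "s \<in> orbit \<sigma> v"
      then have "s \<notin> set cs" using 3 by auto
      then show "switch \<sigma> cs s = \<sigma> s" using switch_outside by metis
    qed
    then show ?thesis by simp
  qed simp
qed

text \<open>By the spacing, the short old cycle of \<open>u\<close> contains no other element of
  \<open>cs\<close>. If the new cycle is short too, it contains the old cycles of both
  \<open>u\<close> and \<open>p\<close>.\<close>

lemma card_orbit_switch_less:
  assumes u: "u \<in> set cs" "card (orbit \<sigma> u) < L" and p: "p \<in> set cs" "p \<noteq> u"
  shows "card (orbit \<sigma> u) < card (orbit (switch \<sigma> cs) u)"
proof (cases "card (orbit (switch \<sigma> cs) u) < L")
  case True
  have "orbit (switch \<sigma> cs) u \<inter> set cs \<noteq> {}"
    using u(1) permutation_self_in_orbit[OF permutation_switch] by blast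
  from orbits_merge[OF this True] have sub: "orbit \<sigma> u \<subseteq> orbit (switch \<sigma> cs) u" "orbit \<sigma> p \<subseteq> orbit (switch \<sigma> cs) u"
    using u p by auto
  have "p \<in> orbit \<sigma> p" by (rule permutation_self_in_orbit[OF permutation_\<sigma>])
  moreover have "p \<notin> orbit \<sigma> u"
  proof
    assume "p \<in> orbit \<sigma> u"
    then have "p \<in> (\<lambda>m. (\<sigma> ^^ m) u) ` {1..card (orbit \<sigma> u)}"
      using orbit_eq_funpow_image[OF permutation_\<sigma>, of u] by simp
    then obtain m where "m \<le> card (orbit \<sigma> u)" "p = (\<sigma> ^^ m) u" by auto
    then show False using spaced[OF u(1) p(1), of m] p(2) u(2) by auto
  qed
  ultimately have "orbit \<sigma> u \<subset> orbit (switch \<sigma> cs) u" using sub by auto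
  then show ?thesis using psubset_card_mono[OF finite_orbit_switch] by blast
qed (use u in simp)

end

text \<open>Distinctness is left out on purpose: it is tracked through multisets of vertices and
  recovered from the total.\<close>

definition is_cycle :: "('a \<Rightarrow> 'a \<Rightarrow> bool) \<Rightarrow> 'a list \<Rightarrow> bool" where
  "is_cycle E c \<longleftrightarrow> c \<noteq> [] \<and> successively E c \<and> E (last c) (hd c)"

text \<open>Orbits are peeled off one at a time. The permutation stays fixed while the invariant set
  \<open>W\<close> shrinks, and each orbit uses up at least \<open>L\<close> vertices.\<close>

lemma cycles_of_permutation:
  assumes perm: "permutation \<sigma>"
  shows "finite W \<Longrightarrow> (\<And>w. w \<in> W \<Longrightarrow> \<sigma> w \<in> W \<and> E w (\<sigma> w) \<and> L \<le> card (orbit \<sigma> w)) \<Longrightarrow>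
    \<exists>Cs. mset (concat Cs) = mset_set W \<and> (\<forall>c\<in>set Cs. is_cycle E c) \<and> length Cs * L \<le> card W"
proof (induction "card W" arbitrary: W rule: less_induct)
  case less
  show ?case
  proof (cases "W = {}")
    case True
    then show ?thesis by (intro exI[of _ "[]"]) auto
  next
    case False
    then obtain v where v: "v \<in> W" by auto
    let ?O = "orbit \<sigma> v"
    let ?k = "card ?O"
    let ?c = "map (\<lambda>m. (\<sigma> ^^ m) v) [1..<Suc ?k]"
    have v_in: "v \<in> ?O" by (rule permutation_self_in_orbit[OF perm])
    have finO: "finite ?O" using v_in finite_orbit by metis
    then have k: "0 < ?k" using v_in card_gt_0_iff by blast
    have OW: "?O \<subseteq> W"
    proof
      fix w assume "w \<in> ?O"
      then show "w \<in> W" by induction (use less.prems v in auto)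
    qed
    have set_c: "set ?c = ?O"
      using orbit_eq_funpow_image[OF perm, of v] by (simp add: atLeastLessThanSuc_atLeastAtMost del: upt_Suc)
    have dist: "distinct ?c"
      using inj_on_funpow_orbit[OF perm, of v] unfolding distinct_map by (simp add: atLeastLessThanSuc_atLeastAtMost del: upt_Suc)
    have "(\<sigma> ^^ ?k) v = v"
    proof -
      have "v \<in> (\<lambda>m. (\<sigma> ^^ m) v) ` {1..?k}"
        using v_in orbit_eq_funpow_image[OF perm, of v] by simp
      then obtain m where m: "m \<in> {1..?k}" "v = (\<sigma> ^^ m) v" by auto
      then have "?k \<le> m" using card_orbit_le[of m \<sigma> v] by simp
      then show ?thesis using m by simp
    qed
    moreover have "last ?c = (\<sigma> ^^ ?k) v" using k by (simp add: last_map)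
    moreover have "hd ?c = \<sigma> v" using k by (simp add: upt_rec hd_map del: upt_Suc)
    ultimately have "E (last ?c) (hd ?c)" using less.prems v by simp
    moreover have "successively E ?c"
    proof -
      have "E ((\<sigma> ^^ m) v) (\<sigma> ((\<sigma> ^^ m) v))" for m
        using less.prems OW funpow_in_orbit[OF v_in, of m] by blast
      from this[of "Suc _"] show ?thesis unfolding successively_conv_nth by (simp del: upt_Suc)
    qed
    ultimately have cyc: "is_cycle E ?c" unfolding is_cycle_def using k by auto
    let ?W = "W - ?O"
    have "card ?W < card W" using v v_in less.prems(1) by (intro psubset_card_mono) auto
    moreover have "finite ?W" using less.prems by simp
    moreover have "\<sigma> w \<in> ?W \<and> E w (\<sigma> w) \<and> L \<le> card (orbit \<sigma> w)" if w: "w \<in> ?W" for w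
    proof -
      have "\<sigma> w \<notin> ?O"
      proof
        assume a: "\<sigma> w \<in> ?O"
        have "w \<in> orbit \<sigma> (\<sigma> w)"
          using permutation_self_in_orbit[OF perm, of w] permutation_orbit_step[OF perm, of w] by simp
        then show False using orbit_trans[OF _ a] w by blast
      qed
      then show ?thesis using less.prems(2) w by auto
    qed
    ultimately obtain Cs where Cs: "mset (concat Cs) = mset_set ?W" "\<forall>c\<in>set Cs. is_cycle E c"
        "length Cs * L \<le> card ?W" using less.hyps[of ?W] by blast
    have "mset ?c = mset_set ?O" using set_c dist mset_set_set by metis
    moreover have "mset_set W = mset_set ?O + mset_set ?W"
      using OW less.prems(1) finO by (subst mset_set_Union[symmetric]) (auto simp: Un_absorb1)
    ultimately have "mset (concat (?c # Cs)) = mset_set W" using Cs(1) by (simp del: upt_Suc)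
    moreover have "length (?c # Cs) * L \<le> card W"
    proof -
      have "L \<le> ?k" using less.prems v by blast
      moreover have "card ?W = card W - ?k" using OW finO by (simp add: card_Diff_subset)
      moreover have "?k \<le> card W" using OW less.prems(1) by (rule card_mono[rotated])
      ultimately show ?thesis using Cs(3) by (simp del: upt_Suc)
    qed
    ultimately show ?thesis using Cs(2) cyc by (intro exI[of _ "?c # Cs"]) (auto simp del: upt_Suc)
  qed
qed

context dense_oriented
begin

text \<open>A 1-factor maximising the sum of the cycle lengths truncated at \<open>L\<close> works.
  Truncation makes the sum monotone under spaced switches, and one through a vertex of a short cycle
  increases it strictly.\<close>

lemma long_cycle_factor:
  assumes W: "W \<subseteq> V" and few: "2 * real (card (V - W)) \<le> nu"
    and L: "real ((R + 1) * (2 * L + 2)) < nu"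
  obtains \<sigma> where "\<sigma> permutes W" "\<And>u. u \<in> W \<Longrightarrow> E u (\<sigma> u)" "\<And>u. u \<in> W \<Longrightarrow> L \<le> card (orbit \<sigma> u)"
proof -
  have finW: "finite W" using W finite_V finite_subset by auto
  let ?P = "{\<sigma>. \<sigma> permutes W \<and> (\<forall>u\<in>W. E u (\<sigma> u))}"
  let ?val = "\<lambda>\<sigma>. \<Sum>v\<in>W. min L (card (orbit \<sigma> v))"
  have finP: "finite ?P" using finite_permutations[OF finW] by (rule rev_finite_subset) auto
  obtain \<sigma>\<^sub>0 where "\<sigma>\<^sub>0 permutes W" "\<And>u. u \<in> W \<Longrightarrow> E u (\<sigma>\<^sub>0 u)" using one_factor[OF W few] by blast
  then have "finite (?val ` ?P)" "?val ` ?P \<noteq> {}" using finP by auto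
  from Max_in[OF this] obtain \<sigma> where \<sigma>: "\<sigma> permutes W" "\<forall>u\<in>W. E u (\<sigma> u)" "?val \<sigma> = Max (?val ` ?P)" by auto
  then have max: "?val \<tau> \<le> ?val \<sigma>" if "\<tau> \<in> ?P" for \<tau>
    using that finP by simp
  have "L \<le> card (orbit \<sigma> u)" if u: "u \<in> W" for u
  proof (rule ccontr)
    assume "\<not> L \<le> card (orbit \<sigma> u)"
    then have short: "card (orbit \<sigma> u) < L" by simp
    \<comment> \<open>All vertices within \<open>L\<close> steps of \<open>w\<close> in either
      direction. Thus excluding \<open>K\<close> of later vertices only already gives the symmetric
      spacing.\<close>
    let ?K = "\<lambda>w. (\<lambda>m. (\<sigma> ^^ m) w) ` {..L} \<union> (\<lambda>m. (inv \<sigma> ^^ m) w) ` {..L}"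
    have K: "finite (?K w) \<and> card (?K w) \<le> 2 * L + 2" for w
    proof -
      have "card (?K w) \<le> card ((\<lambda>m. (\<sigma> ^^ m) w) ` {..L}) + card ((\<lambda>m. (inv \<sigma> ^^ m) w) ` {..L})"
        by (rule card_Un_le)
      also have "\<dots> \<le> Suc L + Suc L"
        by (intro add_mono order_trans[OF card_image_le]) auto
      finally show ?thesis by simp
    qed
    have far: "(\<sigma> ^^ m) v \<noteq> w" "(\<sigma> ^^ m) w \<noteq> v" if "v \<notin> ?K w" "m \<le> L" for v w m
    proof -
      show "(\<sigma> ^^ m) w \<noteq> v" using that by auto
      show "(\<sigma> ^^ m) v \<noteq> w"
      proof
        assume "(\<sigma> ^^ m) v = w"
        moreover have "bij \<sigma>" using \<sigma>(1) permutes_bij by blast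
        ultimately have "(inv \<sigma> ^^ m) w = v" using inv_fn[of \<sigma> m] inj_fn[of \<sigma> m] by (metis bij_is_inj inv_f_f)
        then show False using that by auto
      qed
    qed
    have "real (card (?K u) + R * (2 * L + 2)) \<le> real ((R + 1) * (2 * L + 2))"
      using K[of u] by (intro of_nat_mono) (simp add: algebra_simps)
    then have less: "real (card (?K u) + R * (2 * L + 2)) < nu" using L by linarith
    have "\<sigma> u \<in> W" using u permutes_in_image[OF \<sigma>(1)] by simp
    then have xy: "u \<in> V" "\<sigma> u \<in> V" using u W by auto
    obtain us where us: "length us = R" "set us \<subseteq> W - ?K u" "E u (\<sigma> (hd us))"
      "successively (\<lambda>v w. E v (\<sigma> w)) us" "E (last us) (\<sigma> u)" "sorted_wrt (\<lambda>v w. v \<notin> ?K w) us"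
      using chain[where K = ?K, OF W few \<sigma>(1) xy _ less] K by blast
    have ne: "us \<noteq> []" using us(1) R_def by auto
    have self: "w \<in> ?K w" for w
    proof -
      have "w = (\<sigma> ^^ 0) w" by simp
      then show ?thesis by blast
    qed
    let ?cs = "u # us"
    have "u \<notin> set us" using us(2) self[of u] by blast
    moreover have "distinct us" using distinct_of_sorted_wrt[OF us(6)] self by blast
    ultimately have dist: "distinct ?cs" by simp
    have sub: "set ?cs \<subseteq> W" using us(2) u by auto
    have spaced: "(\<sigma> ^^ m) v \<noteq> w" if "v \<in> set ?cs" "w \<in> set ?cs" "v \<noteq> w" "m \<le> L" for v w m
    proof -
      have "v \<notin> ?K w \<or> w \<notin> ?K v"
      proof (cases "v = u \<or> w = u")
        case True
        then show ?thesis using that us(2) by auto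
      next
        case False
        then have "v \<in> set us" "w \<in> set us" using that by auto
        then show ?thesis using sorted_wrt_cases[OF us(6)] that(3) by blast
      qed
      then show ?thesis using far that(4) by metis
    qed
    let ?\<tau> = "switch \<sigma> ?cs"
    have \<tau>: "?\<tau> \<in> ?P"
    proof -
      have "E v (?\<tau> v)" if v: "v \<in> W" for v
      proof (cases "v \<in> set ?cs")
        case True
        then show ?thesis using switch_edges[of u us E \<sigma>, OF dist ne us(3,4,5) True] by blast
      next
        case False
        then show ?thesis using switch_outside[OF False, of \<sigma>] \<sigma>(2) v by simp
      qed
      then show ?thesis using switch_permutes[OF \<sigma>(1) sub] by blast
    qed
    have "?val \<sigma> < ?val ?\<tau>"
    proof (rule sum_strict_mono_ex1[OF finW])
      show "\<forall>v\<in>W. min L (card (orbit \<sigma> v)) \<le> min L (card (orbit ?\<tau> v))"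
        using min_card_orbit_switch[OF finW \<sigma>(1) dist sub spaced] by simp
      have "hd us \<in> set ?cs" "hd us \<noteq> u" using ne dist by auto
      then have "card (orbit \<sigma> u) < card (orbit ?\<tau> u)"
        using card_orbit_switch_less[OF finW \<sigma>(1) dist sub spaced _ short, of "hd us"] by simp
      then show "\<exists>v\<in>W. min L (card (orbit \<sigma> v)) < min L (card (orbit ?\<tau> v))"
        using short u by (intro bexI[of _ u]) auto
    qed
    then show False using max[OF \<tau>] by simp
  qed
  with \<sigma> that show thesis by blast
qed

lemma long_cycle_cover:
  assumes W: "W \<subseteq> V" and few: "2 * real (card (V - W)) \<le> nu"
    and L: "real ((R + 1) * (2 * L + 2)) < nu"
  obtains Cs where "mset (concat Cs) = mset_set W" "\<forall>c\<in>set Cs. is_cycle E c" "length Cs * L \<le> card W"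
proof -
  obtain \<sigma> where \<sigma>: "\<sigma> permutes W" "\<And>u. u \<in> W \<Longrightarrow> E u (\<sigma> u)" "\<And>u. u \<in> W \<Longrightarrow> L \<le> card (orbit \<sigma> u)"
    using long_cycle_factor[OF assms] by blast
  have finW: "finite W" using W finite_V finite_subset by auto
  then have "permutation \<sigma>" using \<sigma>(1) permutation_permutes by blast
  from cycles_of_permutation[OF this finW, of E L] that show thesis
    using \<sigma> permutes_in_image[OF \<sigma>(1)] by blast
qed

end

section \<open>Gadgets\<close>

text \<open>
  \<open>T\<close> and \<open>T'\<close> are two paths on the same vertices which both leave towards \<open>e\<close>. If \<open>x\<close> sends
  an edge to \<open>b\<close>, then \<open>x T e\<close> can be rerouted as \<open>x P T' e\<close> for every path \<open>P\<close> that starts at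
  an out-neighbour of \<open>x\<close> and ends at an in-neighbour of \<open>f\<close>.
\<close>
definition reroutable :: "('a \<Rightarrow> 'a \<Rightarrow> bool) \<Rightarrow> 'a list \<Rightarrow> 'a list \<Rightarrow> 'a \<Rightarrow> 'a \<Rightarrow> 'a \<Rightarrow> bool" where
  "reroutable E T T' b f e \<longleftrightarrow> T \<noteq> [] \<and> mset T = mset T' \<and> successively E T \<and> successively E T'
     \<and> hd T = b \<and> hd T' = f \<and> E (last T) e \<and> E (last T') e"

text \<open>The first path uses the edges from \<open>w\<close> to \<open>f'\<close> and from
  \<open>v\<close> to \<open>e'\<close>, the second those from \<open>v\<close> to \<open>f\<close>
  and from \<open>w\<close> to \<open>e'\<close>. The piece from \<open>f'\<close> to
  \<open>v\<close> thereby moves from the end to the front, and \<open>f'\<close> becomes the new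
  entry.\<close>

lemma reroutable_extend:
  assumes T: "reroutable E T T' b f e"
    and edges: "E v f" "E v e'" "E w e'" "E w f'"
    and paths: "successively E (e # ps @ [w])" "successively E (f' # qs @ [v])"
  shows "reroutable E (T @ (e # ps @ [w]) @ (f' # qs @ [v])) ((f' # qs @ [v]) @ T' @ (e # ps @ [w])) b f' e'"
proof -
  have "T' \<noteq> []" "T \<noteq> []" using T by (auto simp: reroutable_def)
  then show ?thesis using assms unfolding reroutable_def
    by (simp add: successively_append_iff successively_Cons hd_append split: if_splits)
qed

text \<open>
  An antidirected walk \<open>f \<leftarrow> v \<rightarrow> e \<leftarrow> w \<rightarrow> f' \<leftarrow> \<dots>\<close>, cut into the quadruples \<open>(v, e, w, f')\<close>.
\<close>
primrec zigzag :: "('a \<Rightarrow> 'a \<Rightarrow> bool) \<Rightarrow> 'a \<Rightarrow> ('a \<times> 'a \<times> 'a \<times> 'a) list \<Rightarrow> bool" where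
  "zigzag E f [] \<longleftrightarrow> True"
| "zigzag E f (d # ds) \<longleftrightarrow> (case d of (v, e, w, f') \<Rightarrow> E v f \<and> E v e \<and> E w e \<and> E w f' \<and> zigzag E f' ds)"

primrec zigzag_end :: "'a \<Rightarrow> ('a \<times> 'a \<times> 'a \<times> 'a) list \<Rightarrow> 'a" where
  "zigzag_end f [] = f"
| "zigzag_end f (d # ds) = (case d of (v, e, w, f') \<Rightarrow> zigzag_end f' ds)"

definition zigzag_verts :: "('a \<times> 'a \<times> 'a \<times> 'a) list \<Rightarrow> 'a list" where
  "zigzag_verts ds = concat (map (\<lambda>(v, e, w, f). [v, e, w, f]) ds)"

lemma zigzag_verts_simps [simp]:
  "zigzag_verts [] = []"
  "zigzag_verts ((v, e, w, f) # ds) = [v, e, w, f] @ zigzag_verts ds"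
  unfolding zigzag_verts_def by simp_all

lemma length_zigzag_verts: "length (zigzag_verts ds) = 4 * length ds"
  by (induction ds) auto

text \<open>Two consecutive vertices and their images form a quadruple. The vertex left over by the
  odd length is completed by \<open>z\<close>, with \<open>y\<close> in place of an image.\<close>

fun zigzag_of :: "('a \<Rightarrow> 'a) \<Rightarrow> 'a \<Rightarrow> 'a \<Rightarrow> 'a list \<Rightarrow> ('a \<times> 'a \<times> 'a \<times> 'a) list" where
  "zigzag_of \<sigma> z y [] = []"
| "zigzag_of \<sigma> z y [v] = [(v, \<sigma> v, z, y)]"
| "zigzag_of \<sigma> z y (v # w # ws) = (v, \<sigma> v, w, \<sigma> w) # zigzag_of \<sigma> z y ws"

lemma zigzag_of:
  assumes "odd (length ws)"
  shows "zigzag_end f (zigzag_of \<sigma> z y ws) = y" (is ?A)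
    and "2 * length (zigzag_of \<sigma> z y ws) = length ws + 1" (is ?B)
    and "mset (zigzag_verts (zigzag_of \<sigma> z y ws)) = mset (ws @ map \<sigma> ws @ [z, y])" (is ?C)
    and "\<lbrakk>successively (\<lambda>v w. E w (\<sigma> v)) ws; E (hd ws) f; \<And>u. u \<in> set ws \<Longrightarrow> E u (\<sigma> u);
      E z (\<sigma> (last ws)); E z y\<rbrakk> \<Longrightarrow> zigzag E f (zigzag_of \<sigma> z y ws)"
proof -
  show ?A ?B ?C using assms by (induction \<sigma> z y ws arbitrary: f rule: zigzag_of.induct) auto
  show "\<lbrakk>successively (\<lambda>v w. E w (\<sigma> v)) ws; E (hd ws) f; \<And>u. u \<in> set ws \<Longrightarrow> E u (\<sigma> u);
      E z (\<sigma> (last ws)); E z y\<rbrakk> \<Longrightarrow> zigzag E f (zigzag_of \<sigma> z y ws)"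
    using assms
  proof (induction \<sigma> z y ws arbitrary: f rule: zigzag_of.induct)
    case (3 \<sigma> z y v w ws)
    then have ne: "ws \<noteq> []" by auto
    have "zigzag E (\<sigma> w) (zigzag_of \<sigma> z y ws)"
      using "3.prems" ne by (intro "3.IH") (auto simp: successively_Cons)
    then show ?case using "3.prems" by simp
  qed auto
qed

text \<open>Keeping both ends allows \<open>g\<close> to be replaced inside a longer path. With
  multisets, disjointness of \<open>ps\<close> from \<open>g\<close> need not be stated.\<close>

definition absorbs :: "('a \<Rightarrow> 'a \<Rightarrow> bool) \<Rightarrow> 'a list \<Rightarrow> 'a \<Rightarrow> 'a \<Rightarrow> bool" where
  "absorbs E g s t \<longleftrightarrow> (\<forall>ps. ps \<noteq> [] \<and> successively E ps \<and> hd ps = s \<and> last ps = t \<longrightarrow>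
     (\<exists>g'. g' \<noteq> [] \<and> hd g' = hd g \<and> last g' = last g \<and> successively E g' \<and> mset g' = mset g + mset ps))"

lemma absorbs_of_reroutable:
  assumes T: "reroutable E T T' b f e" and "E x s" "E t f"
  shows "absorbs E (x # T @ [e]) s t"
  unfolding absorbs_def
proof (intro allI impI)
  fix ps assume ps: "ps \<noteq> [] \<and> successively E ps \<and> hd ps = s \<and> last ps = t"
  have "T' \<noteq> []" using T by (auto simp: reroutable_def)
  then show "\<exists>g'. g' \<noteq> [] \<and> hd g' = hd (x # T @ [e]) \<and> last g' = last (x # T @ [e]) \<and> successively E g'
      \<and> mset g' = mset (x # T @ [e]) + mset ps"
    using assms ps unfolding reroutable_def
    by (intro exI[of _ "x # ps @ T' @ [e]"]) (auto simp: successively_append_iff successively_Cons)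
qed

context dense_oriented
begin

lemma double_le_nu_mono: "2 * real (b :: nat) \<le> nu \<Longrightarrow> a \<le> b \<Longrightarrow> 2 * real a \<le> nu"
  by (meson mult_left_mono of_nat_mono order_trans zero_le_numeral)

lemma le_nu_of_double: "2 * real (a :: nat) \<le> nu \<Longrightarrow> real a \<le> nu"
  by simp

text \<open>Every quadruple adds two paths with \<open>R\<close> inner vertices and their four ends,
  and moves the entry of the second path along the zigzag.\<close>

lemma reroutable_along_zigzag:
  "\<lbrakk>reroutable E T T' b f e; zigzag E f ds; distinct (T @ e # zigzag_verts ds);
    set (T @ e # zigzag_verts ds) \<subseteq> V - F; finite F;
    2 * real (card F + length T + 1 + length ds * (2 * R + 4)) \<le> nu\<rbrakk> \<Longrightarrow>
   \<exists>T2 T2' e2. reroutable E T2 T2' b (zigzag_end f ds) e2 \<and> distinct (T2 @ [e2])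
     \<and> set (T2 @ [e2]) \<subseteq> V - F \<and> length T2 = length T + length ds * (2 * R + 4)"
proof (induction ds arbitrary: T T' f e)
  case Nil
  then show ?case by (intro exI[of _ T] exI[of _ T'] exI[of _ e]) simp
next
  case (Cons d ds)
  obtain v e' w f' where d: "d = (v, e', w, f')" by (cases d) auto
  let ?Z = "T @ e # zigzag_verts (d # ds)"
  have Z: "set ?Z \<subseteq> V - F" "distinct ?Z" using Cons.prems by auto
  have edges: "E v f" "E v e'" "E w e'" "E w f'" "zigzag E f' ds" using Cons.prems(2) d by auto
  have len_Z: "length ?Z = length T + 1 + 4 * length (d # ds)"
    using length_zigzag_verts[of "d # ds"] by simp
  \<comment> \<open>The new paths must also avoid the rest of the zigzag, whose vertices are ends of
    paths still to come.\<close>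
  let ?X = "F \<union> set ?Z"
  have fin: "finite ?X" using Cons.prems by simp
  have "card ?X \<le> card F + length ?Z"
    using card_Un_le[of F "set ?Z"] card_length[of ?Z] by linarith
  then have X: "card ?X + R \<le> card F + length T + 1 + length (d # ds) * (2 * R + 4)"
    unfolding len_Z by (simp add: algebra_simps)
  then have X': "2 * real (card ?X + R) \<le> nu"
    by (rule double_le_nu_mono[OF Cons.prems(6)])
  have mem: "e \<in> V" "w \<in> V" "f' \<in> V" "v \<in> V" using Z(1) d by auto
  have "2 * real (card ?X) \<le> nu" using X' by simp
  from path_between[OF mem(1,2) fin this] obtain ps where
    ps: "length ps = R" "distinct ps" "set ps \<subseteq> V - ?X" "successively E (e # ps @ [w])" by metis
  have "card (?X \<union> set ps) \<le> card ?X + R"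
    using card_Un_le[of ?X "set ps"] card_length[of ps] ps(1) by linarith
  then have "2 * real (card (?X \<union> set ps)) \<le> nu" by (rule double_le_nu_mono[OF X'])
  from path_between[OF mem(3,4) _ this] fin obtain qs where
    qs: "length qs = R" "distinct qs" "set qs \<subseteq> V - (?X \<union> set ps)" "successively E (f' # qs @ [v])"
    by (metis finite_Un List.finite_set)
  let ?T = "T @ (e # ps @ [w]) @ (f' # qs @ [v])" and ?T' = "(f' # qs @ [v]) @ T' @ (e # ps @ [w])"
  have re: "reroutable E ?T ?T' b f' e'"
    by (rule reroutable_extend[OF Cons.prems(1) edges(1-4) ps(4) qs(4)])
  have mset_eq: "mset (?T @ e' # zigzag_verts ds) = mset (?Z @ ps @ qs)" unfolding d by simp
  have dist: "distinct (?T @ e' # zigzag_verts ds)"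
  proof -
    have "distinct (ps @ qs)" using ps(2) qs(2,3) by auto
    moreover have "set ?Z \<inter> set (ps @ qs) = {}" using ps(3) qs(3) unfolding set_append by blast
    ultimately have "distinct (?Z @ ps @ qs)" using Z(2) distinct_append[of ?Z "ps @ qs"] by simp
    then show ?thesis using mset_eq_imp_distinct_iff[OF mset_eq] by simp
  qed
  have sub: "set (?T @ e' # zigzag_verts ds) \<subseteq> V - F"
  proof -
    have "set ps \<union> set qs \<subseteq> V - F" using ps(3) qs(3) by blast
    then have "set (?Z @ ps @ qs) \<subseteq> V - F" unfolding set_append[of ?Z] set_append[of ps] using Z(1) by (rule Un_least[rotated])
    then show ?thesis using mset_eq_setD[OF mset_eq] by simp
  qed
  have len: "length ?T = length T + (2 * R + 4)" using ps(1) qs(1) by simp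
  have "2 * real (card F + length ?T + 1 + length ds * (2 * R + 4)) \<le> nu"
    using Cons.prems(6) unfolding len by (simp add: algebra_simps)
  from Cons.IH[OF re edges(5) dist sub Cons.prems(5) this] obtain T2 T2' e2 where
    "reroutable E T2 T2' b (zigzag_end f' ds) e2" "distinct (T2 @ [e2])" "set (T2 @ [e2]) \<subseteq> V - F"
    "length T2 = length ?T + length ds * (2 * R + 4)" by blast
  then show ?case unfolding len d by (intro exI[of _ T2] exI[of _ T2'] exI[of _ e2]) simp
qed

lemma gadget_size: "(20 * q + 1) * (2 * R + 4) + 3 \<le> q ^ 4"
proof -
  have "(20 * q + 1) * (2 * R + 4) + 3 \<le> (21 * q) * (86 * q) + q * q"
    unfolding R_def using q_ge by (intro add_mono mult_mono) (auto intro: order_trans[OF _ mult_le_mono[of 64 q 64 q]])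
  also have "\<dots> = 1807 * (q * q)" by simp
  also have "\<dots> \<le> (q * q) * (q * q)"
    using mult_le_mono[OF q_ge q_ge] by (intro mult_le_mono) auto
  finally show ?thesis by (simp add: power4_eq_xxxx mult.assoc)
qed

lemma obtain_out_neighbour:
  assumes "x \<in> V" "finite X" "real (card X) \<le> nu"
  obtains y where "E x y" "y \<in> V" "y \<notin> X"
proof -
  have "real (card X) < real (card {y \<in> V. E x y})"
    using outdeg[OF assms(1)] assms(3) nu_pos card_V_pos unfolding degree_eq by linarith
  then have "card X < card {y \<in> V. E x y}" by (simp only: of_nat_less_iff)
  with ex_in_diff_of_card_less[OF assms(2) this] that show thesis by blast
qed

lemma obtain_in_neighbour:
  assumes "y \<in> V" "finite X" "real (card X) \<le> nu"
  obtains x where "E x y" "x \<in> V" "x \<notin> X"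
proof -
  have "real (card X) < real (card {x \<in> V. E x y})"
    using indeg[OF assms(1)] assms(3) nu_pos card_V_pos unfolding degree_eq by linarith
  then have "card X < card {x \<in> V. E x y}" by (simp only: of_nat_less_iff)
  with ex_in_diff_of_card_less[OF assms(2) this] that show thesis by blast
qed

lemma R_odd: "odd R"
  unfolding R_def by simp

text \<open>
  The switching sequence \<open>us\<close> from an in-neighbour \<open>z\<close> of \<open>y\<close> to \<open>b\<close>, read backwards together with
  its successors under a 1-factor \<open>\<sigma>\<close>, is a zigzag from \<open>b\<close> to \<open>y\<close>. It ends on the side of \<open>y\<close>
  because \<open>R\<close> is odd.
\<close>
lemma obtain_gadget:
  assumes xy: "x \<in> V - F" "y \<in> V - F" "x \<noteq> y" and F: "finite F" "2 * real (card F + q ^ 4) \<le> nu"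
  obtains g where "g \<noteq> []" "hd g = x" "successively E g" "distinct g" "set g \<subseteq> V - F" "length g \<le> q ^ 4"
    "\<And>s t. \<lbrakk>E x s; E t y\<rbrakk> \<Longrightarrow> absorbs E g s t"
proof -
  have q4: "5 \<le> q ^ 4" using gadget_size by simp
  have small: "real (card (F \<union> set zs)) \<le> nu" "2 * real (card (F \<union> set zs)) \<le> nu" if "length zs \<le> 5" for zs :: "'a list"
  proof -
    have "card (F \<union> set zs) \<le> card F + q ^ 4"
      using card_Un_le[of F "set zs"] card_length[of zs] that q4 by linarith
    then show "2 * real (card (F \<union> set zs)) \<le> nu" by (rule double_le_nu_mono[OF F(2)])
    then show "real (card (F \<union> set zs)) \<le> nu" by (rule le_nu_of_double)
  qed
  obtain b where b: "E x b" "b \<in> V" "b \<notin> F \<union> set [x, y]"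
    using obtain_out_neighbour[of x "F \<union> set [x, y]"] small(1)[of "[x, y]"] xy F by auto
  obtain e where e: "E b e" "e \<in> V" "e \<notin> F \<union> set [x, y, b]"
    using obtain_out_neighbour[of b "F \<union> set [x, y, b]"] small(1)[of "[x, y, b]"] b(2) F by auto
  obtain z where z: "E z y" "z \<in> V" "z \<notin> F \<union> set [x, y, b, e]"
    using obtain_in_neighbour[of y "F \<union> set [x, y, b, e]"] small(1)[of "[x, y, b, e]"] xy F by auto
  let ?X = "F \<union> set [x, y, b, e, z]"
  let ?W = "V - ?X"
  have "card (V - ?W) \<le> card ?X" using F by (intro card_mono) auto
  then have few: "2 * real (card (V - ?W)) \<le> nu"
    using double_le_nu_mono[OF small(2)[of "[x, y, b, e, z]"]] by simp
  have W: "?W \<subseteq> V" by auto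
  obtain \<sigma> where \<sigma>: "\<sigma> permutes ?W" "\<And>u. u \<in> ?W \<Longrightarrow> E u (\<sigma> u)" using one_factor[OF W few] by blast
  \<comment> \<open>Excluding \<open>\<sigma> u\<close> and \<open>inv \<sigma> u\<close> keeps
    \<open>us\<close> disjoint from its image under \<sigma>, so the zigzag repeats no
    vertex.\<close>
  let ?K = "\<lambda>u. set [u, \<sigma> u, inv \<sigma> u]"
  have K: "finite (?K u) \<and> card (?K u) \<le> 3" for u using card_length[of "[u, \<sigma> u, inv \<sigma> u]"] by auto
  have R3: "real (card {} + R * 3) < nu"
  proof -
    have "R * 3 \<le> q ^ 4" using gadget_size by (simp add: R_def algebra_simps)
    from of_nat_mono[OF this, where 'a=real] show ?thesis using F(2) nu_pos by simp
  qed
  obtain us where us: "length us = R" "set us \<subseteq> ?W - {}" "E z (\<sigma> (hd us))"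
    "successively (\<lambda>v w. E v (\<sigma> w)) us" "E (last us) b" "sorted_wrt (\<lambda>v w. v \<notin> ?K w) us"
    using chain[where K = ?K and c = 3, OF W few \<sigma>(1) z(2) b(2) finite.emptyI R3 K] by blast
  have ne: "us \<noteq> []" using us(1) R_def by auto
  let ?ds = "zigzag_of \<sigma> z y (rev us)"
  have odd: "odd (length (rev us))" using us(1) R_odd by simp
  note zz = zigzag_of[OF odd]
  have zigzag: "zigzag E b ?ds"
    by (rule zz(4)) (use us \<sigma> z ne in \<open>auto simp: hd_rev last_rev\<close>)
  have len: "length ?ds = 20 * q + 1" using zz(2)[of \<sigma> z y] us(1) unfolding R_def by simp
  have mset_eq: "mset ([b] @ e # zigzag_verts ?ds) = mset (us @ map \<sigma> us @ [b, e, z, y])"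
    using zz(3)[of \<sigma> z y] by (simp flip: rev_map)
  have image_W: "\<sigma> ` set us \<subseteq> ?W" using us(2) permutes_in_image[OF \<sigma>(1)] by auto
  have dist: "distinct ([b] @ e # zigzag_verts ?ds)"
  proof -
    have "distinct us" using distinct_of_sorted_wrt[OF us(6)] by simp
    moreover have "distinct (map \<sigma> us)"
      using \<open>distinct us\<close> permutes_inj_on[OF \<sigma>(1)] by (simp add: distinct_map)
    moreover have "set us \<inter> \<sigma> ` set us = {}"
    proof (rule ccontr)
      assume "set us \<inter> \<sigma> ` set us \<noteq> {}"
      then obtain u where u: "u \<in> set us" "\<sigma> u \<in> set us" by auto
      then have "u \<noteq> \<sigma> u" using \<sigma>(2)[of u] asym us(2) by fastforce
      from sorted_wrt_cases[OF us(6) u this] show False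
        using permutes_inverses(2)[OF \<sigma>(1), of u] by simp
    qed
    moreover have "distinct [b, e, z, y]" using b e z by auto
    ultimately have "distinct (us @ map \<sigma> us @ [b, e, z, y])" using us(2) image_W by auto
    then show ?thesis using mset_eq_imp_distinct_iff[OF mset_eq] by simp
  qed
  have sub: "set ([b] @ e # zigzag_verts ?ds) \<subseteq> V - insert x F"
  proof -
    have "set (us @ map \<sigma> us @ [b, e, z, y]) \<subseteq> V - insert x F" using us(2) image_W b e z xy by auto
    then show ?thesis using mset_eq_setD[OF mset_eq] by simp
  qed
  \<comment> \<open>Both paths start as the single vertex \<open>b\<close>; along the zigzag the
    entry of the second one moves from \<open>b\<close> to \<open>y\<close>.\<close>
  have re: "reroutable E [b] [b] b b e" using e by (simp add: reroutable_def)
  have "card (insert x F) + length [b] + 1 + length ?ds * (2 * R + 4) \<le> card F + q ^ 4"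
    using gadget_size xy(1) F(1) unfolding len by (simp add: card_insert_if)
  then have "2 * real (card (insert x F) + length [b] + 1 + length ?ds * (2 * R + 4)) \<le> nu"
    by (rule double_le_nu_mono[OF F(2)])
  from reroutable_along_zigzag[OF re zigzag dist sub _ this] F(1) obtain T T' e' where
    T: "reroutable E T T' b y e'" "distinct (T @ [e'])" "set (T @ [e']) \<subseteq> V - insert x F"
      "length T = length [b] + length ?ds * (2 * R + 4)"
    unfolding zz(1) by blast
  show thesis
  proof (rule that[of "x # T @ [e']"])
    show "successively E (x # T @ [e'])"
      using T(1) b(1) by (auto simp: reroutable_def successively_append_iff successively_Cons)
    show "length (x # T @ [e']) \<le> q ^ 4" using T(4) gadget_size unfolding len by simp
  qed (use T xy absorbs_of_reroutable[OF T(1)] in auto)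
qed

end

section \<open>The absorbing cycle\<close>

text \<open>Averaging: by double counting, the elements of \<open>Y\<close> together carry at least
  c |V| times the total weight, and there are at most |V| of them.\<close>

lemma exists_heavy_element:
  fixes w :: "'a \<Rightarrow> real"
  assumes V: "finite V" "V \<noteq> {}" and Y: "Y \<subseteq> V" and c: "0 < c" and w: "\<And>s. s \<in> V \<Longrightarrow> 0 \<le> w s"
    and deg: "\<And>s. s \<in> V \<Longrightarrow> c * real (card V) \<le> real (card {x \<in> Y. P x s})"
  shows "\<exists>x\<in>Y. c * (\<Sum>s\<in>V. w s) \<le> (\<Sum>s\<in>{s \<in> V. P x s}. w s)"
proof (rule ccontr)
  assume neg: "\<not> ?thesis"
  have finY: "finite Y" using V Y finite_subset by auto
  have "0 < card V" using V by auto
  moreover obtain s\<^sub>0 where "s\<^sub>0 \<in> V" using V by auto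
  ultimately have "0 < c * real (card V)" "c * real (card V) \<le> real (card {x \<in> Y. P x s\<^sub>0})"
    using deg[of s\<^sub>0] c by auto
  then have Y_ne: "Y \<noteq> {}" by (cases "Y = {}") auto
  let ?w = "\<Sum>s\<in>V. w s"
  have "c * real (card V) * ?w = (\<Sum>s\<in>V. c * real (card V) * w s)" by (rule sum_distrib_left)
  also have "\<dots> \<le> (\<Sum>s\<in>V. real (card {x \<in> Y. P x s}) * w s)"
    using deg w by (intro sum_mono mult_right_mono)
  also have "\<dots> = (\<Sum>s\<in>V. \<Sum>x\<in>{x \<in> Y. P x s}. w s)" by simp
  also have "\<dots> = (\<Sum>x\<in>Y. \<Sum>s\<in>{s \<in> V. P x s}. w s)"
    by (rule sum.swap_restrict[OF V(1) finY])
  also have "\<dots> < (\<Sum>x\<in>Y. c * ?w)"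
    using neg Y_ne finY by (intro sum_strict_mono) auto
  also have "\<dots> = real (card Y) * (c * ?w)" by simp
  also have "\<dots> \<le> real (card V) * (c * ?w)"
    using card_mono[OF V(1) Y] c sum_nonneg[of V w] w by (intro mult_right_mono) auto
  finally show False by (simp add: mult.assoc mult.left_commute)
qed

definition cover_count :: "('a \<Rightarrow> 'a \<Rightarrow> bool) \<Rightarrow> 'a list list \<Rightarrow> 'a \<Rightarrow> 'a \<Rightarrow> nat" where
  "cover_count E Bs s t = length (filter (\<lambda>g. absorbs E g s t) Bs)"

context dense_oriented
begin

text \<open>A pair served fewer than k times alone contributes more than 2^(-k), so a potential of
  at most 2^(-k) means that every pair is served k times.\<close>

definition potential :: "'a list list \<Rightarrow> real" where
  "potential Bs = (\<Sum>s\<in>V. \<Sum>t\<in>V. (1 / 2) ^ cover_count E Bs s t)"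

text \<open>Gadgets and the paths linking them are blocks alike, so that single blocks can be
  replaced later.\<close>

definition chain_of_blocks :: "'a list list \<Rightarrow> bool" where
  "chain_of_blocks Bs \<longleftrightarrow> Bs \<noteq> [] \<and> (\<forall>B\<in>set Bs. B \<noteq> []) \<and> successively E (concat Bs) \<and> distinct (concat Bs)
     \<and> set (concat Bs) \<subseteq> V"

lemma concat_blocks_ne: "chain_of_blocks Bs \<Longrightarrow> concat Bs \<noteq> []"
  unfolding chain_of_blocks_def by (cases Bs) auto

lemma R_le_q4: "R + 1 \<le> q ^ 4"
  using gadget_size by (simp add: R_def algebra_simps)

lemma card_neighbours_outside:
  assumes X: "finite X" "real (card X) \<le> nu" and s: "s \<in> V"
  shows "3 / 8 * real (card V) \<le> real (card {x \<in> V - X. E x s})"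
    "3 / 8 * real (card V) \<le> real (card {x \<in> V - X. E s x})"
proof -
  have "card {x \<in> V. Q x} \<le> card {x \<in> V - X. Q x} + card X" for Q
  proof -
    have "card {x \<in> V. Q x} \<le> card ({x \<in> V - X. Q x} \<union> X)"
      using finite_V X by (intro card_mono) auto
    also have "\<dots> \<le> card {x \<in> V - X. Q x} + card X" by (rule card_Un_le)
    finally show ?thesis .
  qed
  from real_le_add[OF this[of "\<lambda>x. E x s"]] real_le_add[OF this[of "\<lambda>x. E s x"]]
  show "3 / 8 * real (card V) \<le> real (card {x \<in> V - X. E x s})"
    "3 / 8 * real (card V) \<le> real (card {x \<in> V - X. E s x})"
    using indeg[OF s] outdeg[OF s] X(2) nu_pos unfolding degree_eq by linarith+
qed

text \<open>
  Some pair \<open>(x, y)\<close> of unused vertices has \<open>x\<close> before \<open>s\<close> and \<open>t\<close> before \<open>y\<close> for at least a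
  fraction \<open>(3/8)\<^sup>2\<close> of the potential, and a gadget for this pair halves that part.
\<close>
lemma add_gadget:
  assumes Bs: "chain_of_blocks Bs" and small: "2 * real (length (concat Bs) + 2 * q ^ 4) \<le> nu"
  obtains Bs' where "chain_of_blocks Bs'" "length (concat Bs') \<le> length (concat Bs) + 2 * q ^ 4"
    "potential Bs' \<le> 19 / 20 * potential Bs"
proof -
  let ?F = "set (concat Bs)"
  have card_F: "card ?F \<le> length (concat Bs)" by (rule card_length)
  have V_ne: "V \<noteq> {}" using card_V_pos by auto
  define w where "w s t = (1 / 2 :: real) ^ cover_count E Bs s t" for s t
  have w_nonneg: "0 \<le> w s t" for s t unfolding w_def by simp
  have q4: "1 \<le> q ^ 4" using R_le_q4 by simp
  have F1: "real (card ?F) \<le> nu"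
    using double_le_nu_mono[OF small, of "card ?F"] card_F le_nu_of_double by force
  \<comment> \<open>\<open>x\<close> is chosen for the weights summed over \<open>t\<close>, then
    \<open>y\<close> for the weights restricted to out-neighbours of \<open>x\<close>. Each choice
    keeps 3/8, hence 9/64 in all.\<close>
  have "\<exists>x\<in>V - ?F. 3 / 8 * (\<Sum>s\<in>V. \<Sum>t\<in>V. w s t) \<le> (\<Sum>s\<in>{s \<in> V. E x s}. \<Sum>t\<in>V. w s t)"
  proof (rule exists_heavy_element)
    show "3 / 8 * real (card V) \<le> real (card {x \<in> V - ?F. E x s})" if "s \<in> V" for s
      by (rule card_neighbours_outside(1)[OF _ F1 that]) simp
    show "0 \<le> (\<Sum>t\<in>V. w s t)" for s by (intro sum_nonneg w_nonneg)
  qed (use finite_V V_ne in auto)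
  then obtain x where x: "x \<in> V - ?F" "3 / 8 * (\<Sum>s\<in>V. \<Sum>t\<in>V. w s t) \<le> (\<Sum>s\<in>{s \<in> V. E x s}. \<Sum>t\<in>V. w s t)"
    by blast
  let ?F' = "insert x ?F"
  have "card ?F' \<le> length (concat Bs) + 2 * q ^ 4" using card_F q4 by (simp add: card_insert_if)
  then have F2: "real (card ?F') \<le> nu" using double_le_nu_mono[OF small] le_nu_of_double by blast
  let ?w2 = "\<lambda>t. \<Sum>s\<in>{s \<in> V. E x s}. w s t"
  have "\<exists>y\<in>V - ?F'. 3 / 8 * (\<Sum>t\<in>V. ?w2 t) \<le> (\<Sum>t\<in>{t \<in> V. E t y}. ?w2 t)"
  proof (rule exists_heavy_element)
    show "3 / 8 * real (card V) \<le> real (card {y \<in> V - ?F'. E t y})" if "t \<in> V" for t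
      by (rule card_neighbours_outside(2)[OF _ F2 that]) simp
    show "0 \<le> ?w2 t" for t by (intro sum_nonneg w_nonneg)
  qed (use finite_V V_ne in auto)
  then obtain y where y: "y \<in> V - ?F'" "3 / 8 * (\<Sum>t\<in>V. ?w2 t) \<le> (\<Sum>t\<in>{t \<in> V. E t y}. ?w2 t)"
    by blast
  have heavy: "9 / 64 * potential Bs \<le> (\<Sum>s\<in>{s \<in> V. E x s}. \<Sum>t\<in>{t \<in> V. E t y}. w s t)"
  proof -
    have "(\<Sum>t\<in>V. ?w2 t) = (\<Sum>s\<in>{s \<in> V. E x s}. \<Sum>t\<in>V. w s t)" by (rule sum.swap)
    moreover have "(\<Sum>t\<in>{t \<in> V. E t y}. ?w2 t) = (\<Sum>s\<in>{s \<in> V. E x s}. \<Sum>t\<in>{t \<in> V. E t y}. w s t)" by (rule sum.swap)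
    moreover have "potential Bs = (\<Sum>s\<in>V. \<Sum>t\<in>V. w s t)" unfolding potential_def w_def ..
    ultimately show ?thesis using x(2) y(2) by linarith
  qed
  have "card ?F + q ^ 4 \<le> length (concat Bs) + 2 * q ^ 4" using card_F by simp
  from double_le_nu_mono[OF small this]
  have "2 * real (card ?F + q ^ 4) \<le> nu" .
  then obtain g where g: "g \<noteq> []" "hd g = x" "successively E g" "distinct g" "set g \<subseteq> V - ?F" "length g \<le> q ^ 4"
    "\<And>s t. \<lbrakk>E x s; E t y\<rbrakk> \<Longrightarrow> absorbs E g s t"
    using obtain_gadget[of x ?F y] x(1) y(1) by blast
  let ?l = "last (concat Bs)"
  have l: "?l \<in> V" using concat_blocks_ne[OF Bs] Bs last_in_set unfolding chain_of_blocks_def by blast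
  have "card (?F \<union> set g) \<le> length (concat Bs) + 2 * q ^ 4"
    using card_Un_le[of ?F "set g"] card_F card_length[of g] g(6) by linarith
  from double_le_nu_mono[OF small this] have "2 * real (card (?F \<union> set g)) \<le> nu" .
  then obtain ps where ps: "length ps = R" "distinct ps" "set ps \<subseteq> V - (?F \<union> set g)" "successively E (?l # ps @ [x])"
    using path_between[of ?l x "?F \<union> set g"] l x(1) by blast
  have ps_ne: "ps \<noteq> []" using ps(1) R_def by auto
  let ?Bs = "Bs @ [ps, g]"
  have chain: "chain_of_blocks ?Bs"
  proof -
    have "E ?l (hd ps)" "successively E ps" "E (last ps) x"
      using ps(4) ps_ne by (auto simp: successively_Cons successively_append_iff)
    moreover have "set ps \<inter> set g = {}" "set (concat Bs) \<inter> (set ps \<union> set g) = {}" "set ps \<union> set g \<subseteq> V"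
      using ps(3) g(5) by blast+
    ultimately show ?thesis using Bs g(1-4) ps(2) ps_ne unfolding chain_of_blocks_def
      by (simp add: successively_append_iff del: set_concat)
  qed
  have len: "length (concat ?Bs) \<le> length (concat Bs) + 2 * q ^ 4"
    using ps(1) g(6) R_le_q4 by simp
  have mono: "cover_count E Bs s t \<le> cover_count E ?Bs s t" for s t
    unfolding cover_count_def by simp
  have Suc: "Suc (cover_count E Bs s t) \<le> cover_count E ?Bs s t" if "E x s" "E t y" for s t
    unfolding cover_count_def using g(7)[OF that] by simp
  have "potential ?Bs \<le> (\<Sum>s\<in>V. \<Sum>t\<in>V. w s t - (if E x s \<and> E t y then w s t / 2 else 0))"
    unfolding potential_def
  proof (intro sum_mono)
    fix s t
    show "(1 / 2) ^ cover_count E ?Bs s t \<le> w s t - (if E x s \<and> E t y then w s t / 2 else 0)"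
    proof (cases "E x s \<and> E t y")
      case True
      then have "(1 / 2 :: real) ^ cover_count E ?Bs s t \<le> (1 / 2) ^ Suc (cover_count E Bs s t)"
        using Suc by (intro power_decreasing) auto
      then show ?thesis using True unfolding w_def by simp
    next
      case False
      have "(1 / 2 :: real) ^ cover_count E ?Bs s t \<le> (1 / 2) ^ cover_count E Bs s t"
        using mono by (intro power_decreasing) auto
      then show ?thesis unfolding w_def if_not_P[OF False] by simp
    qed
  qed
  also have "\<dots> = potential Bs - (\<Sum>s\<in>V. \<Sum>t\<in>V. if E x s \<and> E t y then w s t / 2 else 0)"
    unfolding potential_def w_def by (simp add: sum_subtractf)
  also have "(\<Sum>s\<in>V. \<Sum>t\<in>V. if E x s \<and> E t y then w s t / 2 else 0)
      = (\<Sum>s\<in>{s \<in> V. E x s}. \<Sum>t\<in>{t \<in> V. E t y}. w s t) / 2"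
  proof -
    have "(\<Sum>t\<in>V. if E x s \<and> E t y then w s t / 2 else 0)
        = (if E x s then (\<Sum>t\<in>{t \<in> V. E t y}. w s t) / 2 else 0)" for s
      by (auto simp: sum.inter_filter[OF finite_V] sum_divide_distrib intro!: sum.cong)
    then have "(\<Sum>s\<in>V. \<Sum>t\<in>V. if E x s \<and> E t y then w s t / 2 else 0)
        = (\<Sum>s\<in>V. if E x s then (\<Sum>t\<in>{t \<in> V. E t y}. w s t) / 2 else 0)" by simp
    also have "\<dots> = (\<Sum>s\<in>{s \<in> V. E x s}. (\<Sum>t\<in>{t \<in> V. E t y}. w s t) / 2)"
      by (rule sum.inter_filter[OF finite_V, symmetric])
    also have "\<dots> = (\<Sum>s\<in>{s \<in> V. E x s}. \<Sum>t\<in>{t \<in> V. E t y}. w s t) / 2"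
      by (rule sum_divide_distrib[symmetric])
    finally show ?thesis .
  qed
  \<comment> \<open>Half of the heavy part disappears, at least 9/128 of the potential, which is
    more than 1/20.\<close>
  finally have "potential ?Bs \<le> potential Bs - 9 / 128 * potential Bs" using heavy by linarith
  moreover have "0 \<le> potential Bs" unfolding potential_def by (intro sum_nonneg) simp
  ultimately have "potential ?Bs \<le> 19 / 20 * potential Bs" by linarith
  with chain len that show thesis by blast
qed

text \<open>A single vertex starts the path, with potential at most n^2. Each step adds a gadget and
  a linking path, both of at most q^4 vertices.\<close>

lemma add_gadgets:
  "2 * real (1 + N * (2 * q ^ 4)) \<le> nu \<Longrightarrow>
    \<exists>Bs. chain_of_blocks Bs \<and> length (concat Bs) \<le> 1 + N * (2 * q ^ 4)
      \<and> potential Bs \<le> (19 / 20) ^ N * real (card V) ^ 2"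
proof (induction N)
  case 0
  obtain v where v: "v \<in> V" using card_V_pos by fastforce
  have "potential [[v]] \<le> (\<Sum>s\<in>V. \<Sum>t\<in>V. 1)"
    unfolding potential_def by (intro sum_mono power_le_one) auto
  then show ?case using v
    by (intro exI[of _ "[[v]]"]) (simp add: chain_of_blocks_def power2_eq_square)
next
  case (Suc N)
  have "2 * real (1 + N * (2 * q ^ 4)) \<le> nu" by (rule double_le_nu_mono[OF Suc.prems]) simp
  from Suc.IH[OF this] obtain Bs where Bs: "chain_of_blocks Bs" "length (concat Bs) \<le> 1 + N * (2 * q ^ 4)"
    "potential Bs \<le> (19 / 20) ^ N * real (card V) ^ 2" by blast
  have "2 * real (length (concat Bs) + 2 * q ^ 4) \<le> nu"
    by (rule double_le_nu_mono[OF Suc.prems]) (use Bs(2) in simp)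
  from add_gadget[OF Bs(1) this] obtain Bs' where Bs': "chain_of_blocks Bs'"
    "length (concat Bs') \<le> length (concat Bs) + 2 * q ^ 4" "potential Bs' \<le> 19 / 20 * potential Bs" by blast
  have "potential Bs' \<le> (19 / 20) ^ Suc N * real (card V) ^ 2" using Bs'(3) Bs(3) by simp
  then show ?case using Bs' Bs(2) by (intro exI[of _ Bs']) simp
qed

lemma cover_count_ge:
  assumes pot: "potential Bs \<le> (1 / 2) ^ k" and st: "s \<in> V" "t \<in> V"
  shows "k \<le> cover_count E Bs s t"
proof -
  have "(1 / 2) ^ cover_count E Bs s t \<le> (\<Sum>t\<in>V. (1 / 2 :: real) ^ cover_count E Bs s t)"
    using finite_V st by (intro member_le_sum) auto
  also have "\<dots> \<le> potential Bs"
    unfolding potential_def using finite_V st by (intro member_le_sum[where i = s]) (auto intro: sum_nonneg)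
  finally have "(1 / 2 :: real) ^ cover_count E Bs s t \<le> (1 / 2) ^ k" using pot by linarith
  then show ?thesis by (simp add: power_decreasing_iff)
qed

lemma Suc_square_le: "(m + 1) ^ 2 \<le> 4 * 2 ^ m" for m :: nat
proof -
  have "(m + 1) ^ 2 \<le> 4 * 2 ^ m" if "2 \<le> m"
    using that
  proof (induction m rule: nat_induct_at_least)
    case (Suc m)
    have "2 * 2 \<le> m * m" using Suc.hyps by (intro mult_le_mono)
    then show ?case using Suc.IH by (simp add: power2_eq_square)
  qed simp
  moreover have "m = 0 \<or> m = 1 \<or> 2 \<le> m" by linarith
  ultimately show ?thesis by (auto simp: power2_eq_square)
qed

text \<open>For the least such \<open>l\<close>, 2^(l - 1) \<le> n gives l^2 \<le> 4n, which is
  enough: the square of l q^13 is then at most 128 q^27 \<open>nu\<close>, below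
  \<open>nu\<close>^2.\<close>

lemma obtain_log_bound:
  obtains l where "card V \<le> 2 ^ l" "real l * real q ^ 13 \<le> nu"
proof -
  define l where "l = (LEAST l. card V \<le> 2 ^ l)"
  have "card V \<le> 2 ^ card V" using less_exp by (rule less_imp_le)
  then have l: "card V \<le> 2 ^ l" unfolding l_def by (rule LeastI)
  have "real l * real q ^ 13 \<le> nu"
  proof (cases l)
    case 0
    then show ?thesis using nu_pos by simp
  next
    case (Suc m)
    then have "m < (LEAST l. card V \<le> 2 ^ l)" unfolding l_def by simp
    from not_less_Least[OF this] have "2 ^ m \<le> card V" by simp
    with Suc_square_le[of m] have "l ^ 2 \<le> 4 * card V" unfolding Suc by simp
    from of_nat_mono[OF this, where 'a=real] have l2: "real l ^ 2 \<le> 128 * real q * nu"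
      by (simp add: card_V_eq)
    have "(real l * real q ^ 13) ^ 2 = real l ^ 2 * real q ^ 26"
      by (simp add: power_mult_distrib power_mult[symmetric])
    also have "\<dots> \<le> 128 * real q * nu * real q ^ 26" using l2 by (intro mult_right_mono) auto
    also have "\<dots> = 128 * real q ^ 27 * nu" using power_Suc[of "real q" 26] by simp
    also have "\<dots> \<le> real q ^ 2 * real q ^ 27 * nu"
    proof -
      have "128 \<le> real q ^ 2" using power_mono[of 64 "real q" 2] q_ge by simp
      then show ?thesis using nu_pos by (intro mult_right_mono) auto
    qed
    also have "\<dots> = real q ^ 29 * nu" by (simp flip: power_add)
    also have "\<dots> \<le> real q ^ 37 * nu" using nu_pos q_ge by (intro mult_right_mono power_increasing) auto
    also have "\<dots> \<le> nu ^ 2" unfolding power2_eq_square using nu_pos nu_ge by (intro mult_right_mono) auto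
    finally show ?thesis by (rule power2_le_imp_le) (use nu_pos in simp)
  qed
  with l that show thesis by blast
qed

text \<open>The part growing with log n takes at most \<open>nu\<close>/2, and everything else is at
  most 2 q^11, hence at most \<open>nu\<close>/32.\<close>

lemma absorber_size:
  assumes l: "real l * real q ^ 13 \<le> nu" and k: "k \<le> q ^ 6"
  shows "2 * real (1 + 16 * (2 * l + k) * (2 * q ^ 4) + R) \<le> nu"
proof -
  have q: "64 \<le> real q" using q_ge by simp
  have q1: "1 \<le> real q" using q by simp
  have q2: "4096 \<le> real q ^ 2" using power_mono[of 64 "real q" 2] q by simp
  have kr: "real k \<le> real q ^ 6" using of_nat_mono[OF k, where 'a=real] by simp
  have "2 * real (1 + 16 * (2 * l + k) * (2 * q ^ 4) + R)
      = 2 + 2 * real R + 128 * (real l * real q ^ 4) + 64 * (real k * real q ^ 4)"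
    by (simp add: algebra_simps)
  moreover have "2 + 2 * real R \<le> real q ^ 11"
  proof -
    have "2 + 2 * real R \<le> 64 * real q ^ 2" using R_le q2 by linarith
    also have "\<dots> \<le> real q * real q ^ 2" using q by (intro mult_right_mono) auto
    also have "\<dots> = real q ^ 3" by (simp add: power3_eq_cube power2_eq_square)
    also have "\<dots> \<le> real q ^ 11" using q1 by (intro power_increasing) auto
    finally show ?thesis .
  qed
  moreover have "64 * (real k * real q ^ 4) \<le> real q ^ 11"
  proof -
    have "64 * (real k * real q ^ 4) \<le> real q * (real q ^ 6 * real q ^ 4)"
      using q kr by (intro mult_mono) auto
    also have "\<dots> = real q ^ 11" by (simp flip: power_add power_Suc)
    finally show ?thesis .
  qed
  moreover have "64 * real q ^ 11 \<le> nu"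
  proof -
    have "64 * real q ^ 11 \<le> real q * real q ^ 11" using q by (intro mult_right_mono) auto
    also have "\<dots> = real q ^ 12" using power_Suc[of "real q" 11] by simp
    also have "\<dots> \<le> real q ^ 37" using q1 by (intro power_increasing) auto
    finally show ?thesis using nu_ge by simp
  qed
  moreover have "256 * (real l * real q ^ 4) \<le> nu"
  proof -
    have "256 \<le> real q ^ 2" using q2 by simp
    also have "\<dots> \<le> real q ^ 9" using q1 by (intro power_increasing) auto
    finally have "256 * (real l * real q ^ 4) \<le> real q ^ 9 * (real l * real q ^ 4)" by (intro mult_right_mono) auto
    also have "\<dots> = real l * real q ^ 13" using power_add[of "real q" 9 4] by simp
    finally show ?thesis using l by simp
  qed
  ultimately show ?thesis using nu_pos by linarith
qed

lemma obtain_absorber: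
  assumes k: "k \<le> q ^ 6"
  obtains Bs where "\<forall>B\<in>set Bs. B \<noteq> []" "is_cycle E (concat Bs)" "distinct (concat Bs)" "set (concat Bs) \<subseteq> V"
    "2 * real (length (concat Bs)) \<le> nu" "\<And>s t. \<lbrakk>s \<in> V; t \<in> V\<rbrakk> \<Longrightarrow> k \<le> cover_count E Bs s t"
proof -
  obtain l where l: "card V \<le> 2 ^ l" "real l * real q ^ 13 \<le> nu" by (rule obtain_log_bound)
  \<comment> \<open>Sixteen gadgets at least halve the potential, since (19/20)^16 \<le> 1/2. Of the
    resulting halvings, 2 l cancel the initial n^2 and \<open>k\<close> remain.\<close>
  let ?N = "16 * (2 * l + k)"
  note size = absorber_size[OF l(2) k]
  have "2 * real (1 + ?N * (2 * q ^ 4)) \<le> nu" by (rule double_le_nu_mono[OF size]) simp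
  from add_gadgets[OF this] obtain Bs where Bs: "chain_of_blocks Bs" "length (concat Bs) \<le> 1 + ?N * (2 * q ^ 4)"
    "potential Bs \<le> (19 / 20) ^ ?N * real (card V) ^ 2" by blast
  have "(19 / 20 :: real) ^ ?N * real (card V) ^ 2 \<le> (1 / 2) ^ k"
  proof -
    have "(19 / 20 :: real) ^ 16 \<le> 1 / 2" by (simp add: power_divide)
    then have "((19 / 20 :: real) ^ 16) ^ (2 * l + k) \<le> (1 / 2) ^ (2 * l + k)" by (intro power_mono) auto
    moreover have "real (card V) ^ 2 \<le> (2 ^ l) ^ 2"
      using of_nat_mono[OF l(1), where 'a=real] by (intro power_mono) auto
    ultimately have "(19 / 20 :: real) ^ ?N * real (card V) ^ 2 \<le> (1 / 2) ^ (2 * l + k) * (2 ^ l) ^ 2"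
      unfolding power_mult by (intro mult_mono) auto
    also have "\<dots> = (1 / 2) ^ k"
      by (simp add: power_add power_mult[symmetric] mult.commute[of 2 l] power_divide)
    finally show ?thesis .
  qed
  then have pot: "potential Bs \<le> (1 / 2) ^ k" using Bs(3) by linarith
  let ?F = "set (concat Bs)" and ?l = "last (concat Bs)" and ?h = "hd (concat Bs)"
  note ne = concat_blocks_ne[OF Bs(1)]
  have FV: "?F \<subseteq> V" using Bs(1) unfolding chain_of_blocks_def by blast
  then have lh: "?l \<in> V" "?h \<in> V" using last_in_set[OF ne] hd_in_set[OF ne] by blast+
  have "card ?F \<le> 1 + ?N * (2 * q ^ 4) + R" using card_length[of "concat Bs"] Bs(2) by linarith
  from double_le_nu_mono[OF size this] obtain ps where
    ps: "length ps = R" "distinct ps" "set ps \<subseteq> V - ?F" "successively E (?l # ps @ [?h])"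
    using path_between[OF lh, of ?F] by blast
  have ps_ne: "ps \<noteq> []" using ps(1) R_def by auto
  have path: "E ?l (hd ps)" "successively E ps" "E (last ps) ?h"
    using ps(4) ps_ne by (auto simp: successively_Cons successively_append_iff)
  show thesis
  proof (rule that[of "Bs @ [ps]"])
    show "is_cycle E (concat (Bs @ [ps]))"
      using path ne ps_ne Bs(1) unfolding is_cycle_def chain_of_blocks_def
      by (simp add: successively_append_iff del: set_concat concat_eq_Nil_conv)
    show "2 * real (length (concat (Bs @ [ps]))) \<le> nu"
      by (rule double_le_nu_mono[OF size]) (use Bs(2) ps(1) in simp)
    show "k \<le> cover_count E (Bs @ [ps]) s t" if "s \<in> V" "t \<in> V" for s t
      using cover_count_ge[OF pot that] unfolding cover_count_def by simp
    show "distinct (concat (Bs @ [ps]))" "set (concat (Bs @ [ps])) \<subseteq> V" "\<forall>B\<in>set (Bs @ [ps]). B \<noteq> []"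
      using Bs(1) ps(2,3) ps_ne FV unfolding chain_of_blocks_def by (auto simp del: set_concat)
  qed
qed

end

section \<open>Hamilton cycles\<close>

lemma is_cycle_replace:
  assumes "is_cycle E (xs @ g @ ys)" "g \<noteq> []" "g' \<noteq> []" "hd g' = hd g" "last g' = last g" "successively E g'"
  shows "is_cycle E (xs @ g' @ ys)"
  using assms unfolding is_cycle_def
  by (auto simp: successively_append_iff hd_append last_append split: if_splits)

text \<open>\<open>U\<close> indexes the blocks still unaltered. A replaced block may have lost its
  absorbing property, so its index is dropped; this costs each remaining cycle at most one gadget,
  while one cycle fewer remains. A cycle is opened between its last and its first list
  entry.\<close>

lemma absorb_cycles:
  "\<lbrakk>is_cycle E (concat Bs); \<forall>B\<in>set Bs. B \<noteq> []; \<forall>c\<in>set Cs. is_cycle E c; U \<subseteq> {..<length Bs};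
    \<And>c. c \<in> set Cs \<Longrightarrow> length Cs \<le> card {i \<in> U. absorbs E (Bs ! i) (hd c) (last c)}\<rbrakk> \<Longrightarrow>
   \<exists>c. is_cycle E c \<and> mset c = mset (concat Bs) + mset (concat Cs)"
proof (induction Cs arbitrary: Bs U)
  case Nil
  then show ?case by auto
next
  case (Cons c Cs)
  have finU: "finite U" using Cons.prems(4) finite_subset by blast
  have "0 < card {i \<in> U. absorbs E (Bs ! i) (hd c) (last c)}" using Cons.prems(5)[of c] by simp
  then obtain i where i: "i \<in> U" "absorbs E (Bs ! i) (hd c) (last c)" by (auto simp: card_gt_0_iff)
  have len: "i < length Bs" using i Cons.prems(4) by auto
  have "c \<noteq> []" "successively E c" using Cons.prems(3) by (auto simp: is_cycle_def)
  with i(2) obtain g' where g': "g' \<noteq> []" "hd g' = hd (Bs ! i)" "last g' = last (Bs ! i)" "successively E g'"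
    "mset g' = mset (Bs ! i) + mset c" unfolding absorbs_def by blast
  let ?Bs = "Bs[i := g']"
  have old: "concat Bs = concat (take i Bs) @ Bs ! i @ concat (drop (Suc i) Bs)"
    using id_take_nth_drop[OF len] by (metis concat.simps(2) concat_append)
  have new: "concat ?Bs = concat (take i Bs) @ g' @ concat (drop (Suc i) Bs)"
    using len by (simp add: upd_conv_take_nth_drop)
  have ne: "Bs ! i \<noteq> []" using Cons.prems(2) len by simp
  have cyc: "is_cycle E (concat ?Bs)"
    unfolding new by (rule is_cycle_replace[OF _ ne g'(1-4)]) (use Cons.prems(1) old in simp)
  have nes: "\<forall>B\<in>set ?Bs. B \<noteq> []" using Cons.prems(2) g'(1) set_update_subset_insert[of Bs i g'] by auto
  have "length Cs \<le> card {j \<in> U - {i}. absorbs E (?Bs ! j) (hd d) (last d)}" if "d \<in> set Cs" for d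
  proof -
    let ?A = "{j \<in> U. absorbs E (Bs ! j) (hd d) (last d)}"
    have "?A - {i} \<subseteq> {j \<in> U - {i}. absorbs E (?Bs ! j) (hd d) (last d)}" by auto
    then have "card (?A - {i}) \<le> card {j \<in> U - {i}. absorbs E (?Bs ! j) (hd d) (last d)}"
      using finU by (intro card_mono) auto
    moreover have "Suc (length Cs) \<le> card ?A" using Cons.prems(5)[of d] that by simp
    moreover have "card ?A - 1 \<le> card (?A - {i})" using finU by (simp add: card_Diff_singleton_if)
    ultimately show ?thesis by linarith
  qed
  moreover have "U - {i} \<subseteq> {..<length ?Bs}" using Cons.prems(4) by auto
  ultimately obtain d where "is_cycle E d" "mset d = mset (concat ?Bs) + mset (concat Cs)"
    using Cons.IH[OF cyc nes, of "U - {i}"] Cons.prems(3) by auto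
  moreover have "mset (concat ?Bs) = mset (concat Bs) + mset c" unfolding new old mset_append using g'(5) by simp
  ultimately show ?case by (intro exI[of _ d]) simp
qed

lemma cover_count_eq_card: "cover_count E Bs s t = card {i \<in> {..<length Bs}. absorbs E (Bs ! i) s t}"
  unfolding cover_count_def by (simp add: length_filter_conv_card)

context dense_oriented
begin

text \<open>Up to rounding, \<open>R\<close> + 1 is about 40 q and the cycle length n/q^5, so the
  product is a constant times n/q^4, that is, a constant times \<open>nu\<close>/q^3.\<close>

lemma cycle_length_size: "real ((R + 1) * (2 * (card V div q ^ 5) + 2)) < nu"
proof -
  have q: "64 \<le> real q" using q_ge by simp
  have q1: "1 \<le> real q" using q by simp
  have pos: "0 < real q ^ 5" using q by simp
  have L: "real (card V div q ^ 5) * real q ^ 5 \<le> real (card V)"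
    using of_nat_mono[OF div_times_less_eq_dividend, of "card V" "q ^ 5", where 'a = real] by simp
  have "real q ^ 5 \<le> real q ^ 39" using q1 by (intro power_increasing) auto
  also have "\<dots> \<le> real (card V)" using of_nat_mono[OF large, where 'a = real] by simp
  finally have "real q ^ 5 \<le> real (card V)" .
  moreover have "(2 * real (card V div q ^ 5) + 2) * real q ^ 5
      = 2 * (real (card V div q ^ 5) * real q ^ 5) + 2 * real q ^ 5" by (simp add: distrib_right)
  ultimately have a: "(2 * real (card V div q ^ 5) + 2) * real q ^ 5 \<le> 4 * real (card V)"
    using L by linarith
  have b: "real (R + 1) \<le> 42 * real q" unfolding R_def using q by simp
  have "real (R + 1) * ((2 * real (card V div q ^ 5) + 2) * real q ^ 5) \<le> 42 * real q * (4 * real (card V))"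
    by (rule mult_mono[OF b a]) auto
  also have "\<dots> = 5376 * real q ^ 2 * nu" unfolding card_V_eq by (simp add: power2_eq_square)
  also have "\<dots> < real q ^ 3 * real q ^ 2 * nu"
  proof -
    have "5376 < real q ^ 3" using power_mono[of 64 "real q" 3] q by simp
    then show ?thesis using nu_pos q by (intro mult_strict_right_mono) auto
  qed
  also have "\<dots> = nu * real q ^ 5" using power_add[of "real q" 3 2] by simp
  finally have "real (R + 1) * (2 * real (card V div q ^ 5) + 2) * real q ^ 5 < nu * real q ^ 5"
    by (simp only: mult.assoc)
  then have "real (R + 1) * (2 * real (card V div q ^ 5) + 2) < nu"
    using pos by (simp only: mult_less_cancel_right_pos)
  then show ?thesis by (simp only: of_nat_mult of_nat_add of_nat_numeral)
qed

lemma obtain_hamilton_cycle: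
  obtains c where "is_cycle E c" "distinct c" "set c = V"
proof -
  let ?k = "q ^ 6" and ?L = "card V div q ^ 5"
  obtain Bs where Bs: "\<forall>B\<in>set Bs. B \<noteq> []" "is_cycle E (concat Bs)" "distinct (concat Bs)" "set (concat Bs) \<subseteq> V"
    "2 * real (length (concat Bs)) \<le> nu" "\<And>s t. \<lbrakk>s \<in> V; t \<in> V\<rbrakk> \<Longrightarrow> ?k \<le> cover_count E Bs s t"
    using obtain_absorber[OF order_refl] by blast
  let ?W = "V - set (concat Bs)"
  have "card (V - ?W) \<le> card (set (concat Bs))" by (rule card_mono) auto
  then have "card (V - ?W) \<le> length (concat Bs)" using card_length order_trans by blast
  from double_le_nu_mono[OF Bs(5) this] have few: "2 * real (card (V - ?W)) \<le> nu" .
  obtain Cs where Cs: "mset (concat Cs) = mset_set ?W" "\<forall>c\<in>set Cs. is_cycle E c" "length Cs * ?L \<le> card ?W"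
    using long_cycle_cover[OF _ few cycle_length_size] by blast
  \<comment> \<open>Rounding down loses less than half of n, because \<open>?L\<close> is at least
    1. So q^6 \<open>?L\<close> \<ge> 64 q^5 \<open>?L\<close> exceeds n.\<close>
  have k: "length Cs \<le> ?k"
  proof (rule ccontr)
    assume "\<not> ?thesis"
    then have "(q ^ 6 + 1) * ?L \<le> length Cs * ?L" by (intro mult_le_mono1) simp
    also have "\<dots> \<le> card V" using Cs(3) card_mono[OF finite_V, of ?W] by (meson Diff_subset le_trans)
    finally have "(q ^ 6 + 1) * ?L \<le> card V" .
    moreover have "q ^ 5 * ?L + card V mod q ^ 5 = card V" by simp
    moreover have "card V mod q ^ 5 < q ^ 5" using q_ge by simp
    moreover have "q * (q ^ 5 * ?L) \<le> q ^ 6 * ?L" by (simp add: power_Suc[symmetric] mult.assoc[symmetric] del: power_Suc)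
    moreover have "64 * (q ^ 5 * ?L) \<le> q * (q ^ 5 * ?L)" using q_ge by (rule mult_le_mono1)
    moreover have "q ^ 5 \<le> q ^ 5 * ?L"
    proof -
      have "q ^ 5 \<le> q ^ 39" using q_ge by (intro power_increasing) auto
      then have "q ^ 5 \<le> card V" using large by linarith
      then have "1 \<le> ?L" using q_ge div_greater_zero_iff[of "card V" "q ^ 5"] by simp
      then show ?thesis by simp
    qed
    moreover have "(q ^ 6 + 1) * ?L = q ^ 6 * ?L + ?L" by simp
    moreover have "0 < q ^ 5" using q_ge by simp
    ultimately show False by linarith
  qed
  have "set (concat Cs) = ?W" using Cs(1) finite_V by (metis finite_Diff finite_set_mset_mset_set set_mset_mset)
  then have sub: "set c \<subseteq> V" if "c \<in> set Cs" for c using that by auto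
  have "length Cs \<le> card {i \<in> {..<length Bs}. absorbs E (Bs ! i) (hd c) (last c)}" if c: "c \<in> set Cs" for c
  proof -
    have "c \<noteq> []" using c Cs(2) by (auto simp: is_cycle_def)
    then have "hd c \<in> V" "last c \<in> V" using sub[OF c] by auto
    from Bs(6)[OF this] k show ?thesis unfolding cover_count_eq_card by linarith
  qed
  with absorb_cycles[OF Bs(2,1) Cs(2) order_refl] obtain c where
    c: "is_cycle E c" "mset c = mset (concat Bs) + mset (concat Cs)" by blast
  have "mset (concat Bs) = mset_set (set (concat Bs))" using Bs(3) by (metis mset_set_set)
  moreover have "mset_set (set (concat Bs) \<union> ?W) = mset_set (set (concat Bs)) + mset_set ?W"
    using finite_V by (intro mset_set_Union) auto
  moreover have "set (concat Bs) \<union> ?W = V" using Bs(4) by blast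
  ultimately have "mset c = mset_set V" unfolding c(2) Cs(1) by simp
  then have set_c: "set c = V"
    using finite_V by (metis finite_set_mset_mset_set set_mset_mset)
  have "size (mset c) = card V" using \<open>mset c = mset_set V\<close> by simp
  then have "distinct c" using set_c by (simp add: card_distinct)
  with set_c c(1) that show thesis by blast
qed

end

section \<open>From adjacency relations back to arcs\<close>

context oriented_graph
begin

lemma card_out_neighbours: "card {y \<in> verts G. x \<rightarrow>\<^bsub>G\<^esub> y} = out_degree G x"
proof -
  have "inj_on (head G) (out_arcs G x)"
    by (rule inj_onI) (auto intro: at_most_one_arc)
  moreover have "{y \<in> verts G. x \<rightarrow>\<^bsub>G\<^esub> y} = head G ` out_arcs G x"
    by (auto simp: in_arcs_imp_in_arcs_ends)
  ultimately show ?thesis unfolding out_degree_def by (simp add: card_image)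
qed

lemma card_in_neighbours: "card {x \<in> verts G. x \<rightarrow>\<^bsub>G\<^esub> y} = in_degree G y"
proof -
  have "inj_on (tail G) (in_arcs G y)"
    by (rule inj_onI) (auto intro: at_most_one_arc)
  moreover have "{x \<in> verts G. x \<rightarrow>\<^bsub>G\<^esub> y} = tail G ` in_arcs G y"
    by (auto simp: in_arcs_imp_in_arcs_ends)
  ultimately show ?thesis unfolding in_degree_def by (simp add: card_image)
qed

lemma min_semidegree_le:
  assumes "v \<in> verts G"
  shows "min_semidegree G \<le> out_degree G v" "min_semidegree G \<le> in_degree G v"
  unfolding min_semidegree_def using assms finite_verts by (auto intro: min.coboundedI1 min.coboundedI2)

text \<open>The walk has one arc for each vertex of \<open>c\<close>, so its end \<open>z\<close> is
  kept apart; \<open>z = hd c\<close> closes it.\<close>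

lemma awalk_of_path:
  assumes "successively (\<lambda>u v. u \<rightarrow>\<^bsub>G\<^esub> v) (c @ [z])" "c \<noteq> []"
  shows "\<exists>p. awalk (hd c) p z \<and> map (tail G) p = c \<and> awalk_verts (hd c) p = c @ [z]"
  using assms
proof (induction c)
  case (Cons u c)
  show ?case
  proof (cases "c = []")
    case True
    then obtain a where "a \<in> arcs G" "tail G a = u" "head G a = z" using Cons.prems by auto
    then show ?thesis using True by (intro exI[of _ "[a]"]) (auto simp: awalk_simps)
  next
    case False
    then obtain p where p: "awalk (hd c) p z" "map (tail G) p = c" "awalk_verts (hd c) p = c @ [z]"
      using Cons by (auto simp: successively_Cons)
    obtain a where a: "a \<in> arcs G" "tail G a = u" "head G a = hd c"
      using Cons.prems False by (auto simp: successively_Cons)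
    then show ?thesis using p by (intro exI[of _ "a # p"]) (auto simp: awalk_simps)
  qed
qed simp

lemma hamilton_cycle_of_is_cycle:
  assumes c: "is_cycle (\<lambda>u v. u \<rightarrow>\<^bsub>G\<^esub> v) c" "distinct c" "set c = verts G"
  shows "\<exists>p. hamilton_cycle p"
proof -
  have "successively (\<lambda>u v. u \<rightarrow>\<^bsub>G\<^esub> v) (c @ [hd c])" "c \<noteq> []"
    using c(1) by (auto simp: is_cycle_def successively_append_iff)
  from awalk_of_path[OF this] obtain p where
    p: "awalk (hd c) p (hd c)" "map (tail G) p = c" "awalk_verts (hd c) p = c @ [hd c]" by blast
  have "distinct (tl (awalk_verts (hd c) p))" unfolding p(3) using c(2) \<open>c \<noteq> []\<close> by (cases c) auto
  moreover have "p \<noteq> []" using p(2) \<open>c \<noteq> []\<close> by auto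
  moreover have "tail G ` set p = verts G" using p(2) c(3) by (metis list.set_map)
  ultimately show ?thesis unfolding hamilton_cycle_def cycle_def using p(1) by blast
qed

end

theorem corollary1p5:
  fixes n :: nat and \<epsilon> :: real and D :: "('a, 'b) pre_digraph"
  assumes "0 < \<epsilon>" and "\<epsilon> < 1 / 64"
    and "real n > \<epsilon> powi (-40)"
    and "oriented_graph D" and "card (verts D) = n"
    and "real (min_semidegree D) > 3 / 8 * real n + \<epsilon> * real n"
  shows "\<exists>p. pre_digraph.hamilton_cycle D p"
proof -
  interpret oriented_graph D by (rule assms(4))
  \<comment> \<open>Rounding up preserves the degree condition, as 1/q \<le> \<epsilon>, and
    enlarges 1/\<epsilon> by a factor of at most 65/64.\<close>
  define q where "q = nat \<lceil>1 / \<epsilon>\<rceil>"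
  have inv: "64 < 1 / \<epsilon>" using assms(1,2) by (simp add: field_simps)
  have q_lower: "1 / \<epsilon> \<le> real q" unfolding q_def using inv by linarith
  have q_upper: "real q \<le> 65 / 64 * (1 / \<epsilon>)" unfolding q_def using inv by linarith
  have q_ge: "64 \<le> q" using q_lower inv by linarith
  have inv_q: "1 / real q \<le> \<epsilon>" using q_lower assms(1) q_ge by (simp add: field_simps)
  have large: "q ^ 39 \<le> n"
  proof -
    have "real q ^ 39 \<le> (65 / 64 * (1 / \<epsilon>)) ^ 39" using q_upper assms(1) by (intro power_mono) auto
    also have "\<dots> = (65 / 64) ^ 39 * (1 / \<epsilon>) ^ 39" by (rule power_mult_distrib)
    \<comment> \<open>The fortieth power of 1/\<epsilon> pays for the rounding: (65/64)^39 \<le> 64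
      < 1/\<epsilon>.\<close>
    also have "\<dots> \<le> 64 * (1 / \<epsilon>) ^ 39" using assms(1) by (intro mult_right_mono) (auto simp: power_divide)
    also have "\<dots> \<le> 1 / \<epsilon> * (1 / \<epsilon>) ^ 39" using inv assms(1) by (intro mult_right_mono) auto
    also have "\<dots> = (1 / \<epsilon>) ^ 40" using power_Suc[of "1 / \<epsilon>" 39] by simp
    also have "\<dots> = \<epsilon> powi (-40)" by (simp add: power_int_def power_divide inverse_eq_divide)
    also have "\<dots> < real n" by (rule assms(3))
    finally show ?thesis by (simp flip: of_nat_power)
  qed
  have deg: "(3 / 8 + 1 / real q) * real n \<le> real (min_semidegree D)"
    using mult_right_mono[OF inv_q, of "real n"] assms(6) by (simp add: distrib_right)
  interpret dense: dense_oriented "verts D" "\<lambda>u v. u \<rightarrow>\<^bsub>D\<^esub> v" q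
  proof
    show "(3 / 8 + 1 / real q) * real (card (verts D)) \<le> real (card {y \<in> verts D. x \<rightarrow>\<^bsub>D\<^esub> y})" if "x \<in> verts D" for x
      using deg min_semidegree_le(1)[OF that] unfolding card_out_neighbours assms(5) by linarith
    show "(3 / 8 + 1 / real q) * real (card (verts D)) \<le> real (card {x \<in> verts D. x \<rightarrow>\<^bsub>D\<^esub> y})" if "y \<in> verts D" for y
      using deg min_semidegree_le(2)[OF that] unfolding card_in_neighbours assms(5) by linarith
  qed (use q_ge large assms(5) no_opposite_arcs in auto)
  obtain c where "is_cycle (\<lambda>u v. u \<rightarrow>\<^bsub>D\<^esub> v) c" "distinct c" "set c = verts D" by (rule dense.obtain_hamilton_cycle)
  then show ?thesis by (rule hamilton_cycle_of_is_cycle)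
qed

end
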